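(* Let $X\subseteq\mathbb{R}$ be a non-empty open interval and let $\phi:X\to X$ be a real analytic diffeomorphism. Then the following are equivalent. (i) $C_\phi:\mathscr{D}'(X)\to\mathscr{D}'(X)$ is power bounded. (ii) $C_\phi:\mathscr{D}'(X)\to\mathscr{D}'(X)$ is mean ergodic. (iii) $C_\phi:\mathscr{D}'(X)\to\mathscr{D}'(X)$ is uniformly mean ergodic. (iv) $\phi(\phi(x))=x$ for each $x\in X$. (v) $C_\phi$ is periodic with period $2$, i.e. $C_\phi^2=\mathrm{id}_{\mathscr{D}'(X)}$.
   Context: A real analytic diffeomorphism is a real analytic bijection whose inverse is real analytic (so $\phi'$ has no zeros). $\mathscr{D}(X)$ is the space of test functions on $X$, and $\mathscr{D}'(X)$ is the space of distributions on $X$, equipped with the strong dual topology $\beta(\mathscr{D}'(X),\mathscr{D}(X))$. The composition operator $C_\phi$ on $\mathscr{D}'(X)$ is given by $$\langle C_\phi u,\varphi\rangle=\left\langle u,\left(\frac{\varphi}{|\phi'|}\right)\circ\phi^{-1}\right\rangle,\quad u\in\mathscr{D}'(X),\ \varphi\in\mathscr{D}(X);$$ it extends $f\mapsto f\circ\phi$ from continuous functions to distributions. For a continuous linear operator $T$ on a locally convex Hausdorff space $E$ put $T^{[n]}=\frac1n\sum_{m=1}^nT^m$. $T$ is power bounded if $\{T^m:m\in\mathbb{N}\}$ is equicontinuous. $T$ is mean ergodic if there is a continuous linear operator $P$ on $E$ with $T^{[n]}x\to Px$ for every $x\in E$; uniformly mean ergodic if the convergence is moreover uniform on bounded subsets of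 $E$. "Periodic with period $2$" does not exclude $C_\phi=\mathrm{id}$. *)

theory Defs
  imports "HOL-Analysis.Analysis"
begin

section \<open>Locally convex spaces of complex-valued functions\<close>

text \<open>
  Every vector space below is a set of functions \<open>'i \<Rightarrow> complex\<close> with pointwise operations:
  test functions with \<open>'i = real\<close>, and functionals on test functions with
  \<open>'i = real \<Rightarrow> complex\<close>. A topological vector space is a topology \<open>E\<close> whose carrier is
  \<open>topspace E\<close>.
\<close>

definition lc_topology ::
    "('i \<Rightarrow> complex) set \<Rightarrow> (('i \<Rightarrow> complex) \<Rightarrow> real) set \<Rightarrow> ('i \<Rightarrow> complex) topology" where
  "lc_topology V P = topology (\<lambda>U. U \<subseteq> V \<and>
     (\<forall>f\<in>U. \<exists>F e. finite F \<and> F \<subseteq> P \<and> e > 0 \<and>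
        {g \<in> V. \<forall>p\<in>F. p (\<lambda>i. g i - f i) < e} \<subseteq> U))"

lemma openin_lc_topology:
  "openin (lc_topology V P) U \<longleftrightarrow> U \<subseteq> V \<and>
     (\<forall>f\<in>U. \<exists>F e. finite F \<and> F \<subseteq> P \<and> e > 0 \<and>
        {g \<in> V. \<forall>p\<in>F. p (\<lambda>i. g i - f i) < e} \<subseteq> U)"
proof -
  define N where "N = (\<lambda>F e f. {g \<in> V. \<forall>p\<in>F. p (\<lambda>i. g i - f i) < (e::real)})"
  define op where "op = (\<lambda>U. U \<subseteq> V \<and> (\<forall>f\<in>U. \<exists>F e. finite F \<and> F \<subseteq> P \<and> e > 0 \<and> N F e f \<subseteq> U))"
  have int: "N (F \<union> G) (min d e) f \<subseteq> N F d f \<inter> N G e f" for F G d e f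
    unfolding N_def by auto
  have "op (S \<inter> T)" if S: "op S" and T: "op T" for S T
    unfolding op_def
  proof (intro conjI ballI)
    show "S \<inter> T \<subseteq> V" using S unfolding op_def by blast
    fix f assume f: "f \<in> S \<inter> T"
    obtain F d where F: "finite F" "F \<subseteq> P" "d > 0" "N F d f \<subseteq> S"
      using S f unfolding op_def by blast
    obtain G e where G: "finite G" "G \<subseteq> P" "e > 0" "N G e f \<subseteq> T"
      using T f unfolding op_def by blast
    have "N (F \<union> G) (min d e) f \<subseteq> S \<inter> T" using int F(4) G(4) by blast
    moreover have "finite (F \<union> G)" "F \<union> G \<subseteq> P" "min d e > 0"
      using F(1-3) G(1-3) by simp_all
    ultimately show "\<exists>F e. finite F \<and> F \<subseteq> P \<and> e > 0 \<and> N F e f \<subseteq> S \<inter> T" by blast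
  qed
  moreover have "op (\<Union>K)" if K: "\<forall>S\<in>K. op S" for K
    unfolding op_def
  proof (intro conjI ballI)
    show "\<Union>K \<subseteq> V" using K unfolding op_def by blast
    fix f assume "f \<in> \<Union>K"
    then obtain S where S: "S \<in> K" "f \<in> S" by (rule UnionE)
    have "op S" using K S(1) by (rule bspec)
    then obtain F e where "finite F" "F \<subseteq> P" "e > 0" "N F e f \<subseteq> S"
      using S(2) unfolding op_def by blast
    moreover from this(4) S(1) have "N F e f \<subseteq> \<Union>K" by blast
    ultimately show "\<exists>F e. finite F \<and> F \<subseteq> P \<and> e > 0 \<and> N F e f \<subseteq> \<Union>K" by blast
  qed
  ultimately have "istopology op" unfolding istopology_def by simp
  then have "openin (topology op) U = op U" by (simp only: topology_inverse')
  then show ?thesis unfolding lc_topology_def op_def N_def .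
qed

lemma topspace_lc_topology [simp]: "topspace (lc_topology V P) = V"
proof
  show "topspace (lc_topology V P) \<subseteq> V"
    using openin_topspace[of "lc_topology V P"] unfolding openin_lc_topology by (rule conjunct1)
  have "openin (lc_topology V P) V"
    unfolding openin_lc_topology
  proof (intro conjI subset_refl ballI)
    fix f assume "f \<in> V"
    show "\<exists>F e. finite F \<and> F \<subseteq> P \<and> (e::real) > 0 \<and> {g \<in> V. \<forall>p\<in>F. p (\<lambda>i. g i - f i) < e} \<subseteq> V"
      by (rule exI[of _ "{}"], rule exI[of _ 1]) simp
  qed
  then show "V \<subseteq> topspace (lc_topology V P)" by (rule openin_subset)
qed

definition seminorm_on :: "('i \<Rightarrow> complex) set \<Rightarrow> (('i \<Rightarrow> complex) \<Rightarrow> real) \<Rightarrow> bool" where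
  "seminorm_on V p \<longleftrightarrow>
     (\<forall>f\<in>V. \<forall>g\<in>V. p (\<lambda>i. f i + g i) \<le> p f + p g) \<and>
     (\<forall>f\<in>V. \<forall>c. p (\<lambda>i. c * f i) = cmod c * p f)"

definition zero_nhd :: "('i \<Rightarrow> complex) topology \<Rightarrow> ('i \<Rightarrow> complex) set \<Rightarrow> bool" where
  "zero_nhd E U \<longleftrightarrow> openin E U \<and> (\<lambda>i. 0) \<in> U"

text \<open>\<open>B\<close> is bounded if every neighbourhood of zero absorbs it.\<close>

definition tvs_bounded :: "('i \<Rightarrow> complex) topology \<Rightarrow> ('i \<Rightarrow> complex) set \<Rightarrow> bool" where
  "tvs_bounded E B \<longleftrightarrow> B \<subseteq> topspace E \<and>
     (\<forall>U. zero_nhd E U \<longrightarrow>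
        (\<exists>r>0. \<forall>c::complex. cmod c \<ge> r \<longrightarrow> B \<subseteq> (\<lambda>f i. c * f i) ` U))"

text \<open>Functionals are extended by zero outside the carrier, so that equality is equality of
  functionals and the dual is closed under pointwise operations.\<close>

definition dual_space :: "('i \<Rightarrow> complex) topology \<Rightarrow> (('i \<Rightarrow> complex) \<Rightarrow> complex) set" where
  "dual_space E = {u. continuous_map E euclidean u \<and>
     (\<forall>f\<in>topspace E. \<forall>g\<in>topspace E. \<forall>a b. u (\<lambda>i. a * f i + b * g i) = a * u f + b * u g) \<and>
     (\<forall>f. f \<notin> topspace E \<longrightarrow> u f = 0)}"

definition strong_dual :: "('i \<Rightarrow> complex) topology \<Rightarrow> (('i \<Rightarrow> complex) \<Rightarrow> complex) topology" where
  "strong_dual E = lc_topology (dual_space E)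
     {\<lambda>u. SUP f\<in>B. cmod (u f) | B. tvs_bounded E B \<and> B \<noteq> {}}"

section \<open>Ergodic properties of operators\<close>

definition continuous_linear_op ::
    "('i \<Rightarrow> complex) topology \<Rightarrow> (('i \<Rightarrow> complex) \<Rightarrow> ('i \<Rightarrow> complex)) \<Rightarrow> bool" where
  "continuous_linear_op E T \<longleftrightarrow> continuous_map E E T \<and>
     (\<forall>x\<in>topspace E. \<forall>y\<in>topspace E. \<forall>a b.
        T (\<lambda>i. a * x i + b * y i) = (\<lambda>i. a * T x i + b * T y i))"

text \<open>For sets of linear operators, equicontinuity is equicontinuity at zero.\<close>

definition equicontinuous_ops ::
    "('i \<Rightarrow> complex) topology \<Rightarrow> (('i \<Rightarrow> complex) \<Rightarrow> ('i \<Rightarrow> complex)) set \<Rightarrow> bool" where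
  "equicontinuous_ops E \<T> \<longleftrightarrow>
     (\<forall>V. zero_nhd E V \<longrightarrow> (\<exists>U. zero_nhd E U \<and> (\<forall>T\<in>\<T>. T ` U \<subseteq> V)))"

definition power_bounded ::
    "('i \<Rightarrow> complex) topology \<Rightarrow> (('i \<Rightarrow> complex) \<Rightarrow> ('i \<Rightarrow> complex)) \<Rightarrow> bool" where
  "power_bounded E T \<longleftrightarrow> equicontinuous_ops E (range (\<lambda>m. T ^^ m))"

definition cesaro_mean ::
    "(('i \<Rightarrow> complex) \<Rightarrow> ('i \<Rightarrow> complex)) \<Rightarrow> nat \<Rightarrow> ('i \<Rightarrow> complex) \<Rightarrow> ('i \<Rightarrow> complex)" where
  "cesaro_mean T n x = (\<lambda>i. 1 / of_nat n * (\<Sum>m=1..n. (T ^^ m) x i))"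

definition mean_ergodic ::
    "('i \<Rightarrow> complex) topology \<Rightarrow> (('i \<Rightarrow> complex) \<Rightarrow> ('i \<Rightarrow> complex)) \<Rightarrow> bool" where
  "mean_ergodic E T \<longleftrightarrow> (\<exists>P. continuous_linear_op E P \<and>
     (\<forall>x\<in>topspace E. limitin E (\<lambda>n. cesaro_mean T n x) (P x) sequentially))"

definition uniformly_mean_ergodic ::
    "('i \<Rightarrow> complex) topology \<Rightarrow> (('i \<Rightarrow> complex) \<Rightarrow> ('i \<Rightarrow> complex)) \<Rightarrow> bool" where
  "uniformly_mean_ergodic E T \<longleftrightarrow> (\<exists>P. continuous_linear_op E P \<and>
     (\<forall>x\<in>topspace E. limitin E (\<lambda>n. cesaro_mean T n x) (P x) sequentially) \<and>
     (\<forall>B. tvs_bounded E B \<longrightarrow> (\<forall>V. zero_nhd E V \<longrightarrow>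
        (\<forall>\<^sub>F n in sequentially. \<forall>x\<in>B. (\<lambda>i. cesaro_mean T n x i - P x i) \<in> V))))"

section \<open>Test functions and distributions\<close>

definition nth_deriv :: "nat \<Rightarrow> (real \<Rightarrow> complex) \<Rightarrow> real \<Rightarrow> complex" where
  "nth_deriv n = (\<lambda>f x. vector_derivative f (at x)) ^^ n"

definition smooth :: "(real \<Rightarrow> complex) \<Rightarrow> bool" where
  "smooth f \<longleftrightarrow> (\<forall>n x. nth_deriv n f differentiable at x)"

text \<open>Test functions on \<open>X\<close> are represented by their extension by zero to the real line. For
  compact \<open>K\<close>, \<open>test_functions K\<close> is the space of smooth functions with support in \<open>K\<close>.\<close>

definition test_functions :: "real set \<Rightarrow> (real \<Rightarrow> complex) set" where
  "test_functions X = {f. smooth f \<and>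
     compact (closure {x. f x \<noteq> 0}) \<and> closure {x. f x \<noteq> 0} \<subseteq> X}"

definition DK_topology :: "real set \<Rightarrow> (real \<Rightarrow> complex) topology" where
  "DK_topology K = lc_topology (test_functions K) {\<lambda>f. SUP x. cmod (nth_deriv n f x) | n. True}"

text \<open>The locally convex inductive limit of the spaces \<open>DK_topology K\<close>, \<open>K \<subseteq> X\<close> compact: its
  continuous seminorms are those with continuous restriction to every step.\<close>

definition D_topology :: "real set \<Rightarrow> (real \<Rightarrow> complex) topology" where
  "D_topology X = lc_topology (test_functions X)
     {p. seminorm_on (test_functions X) p \<and>
         (\<forall>K. compact K \<and> K \<subseteq> X \<longrightarrow> continuous_map (DK_topology K) euclideanreal p)}"

definition distributions :: "real set \<Rightarrow> ((real \<Rightarrow> complex) \<Rightarrow> complex) set" where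
  "distributions X = dual_space (D_topology X)"

definition D'_topology :: "real set \<Rightarrow> ((real \<Rightarrow> complex) \<Rightarrow> complex) topology" where
  "D'_topology X = strong_dual (D_topology X)"

section \<open>Composition operators\<close>

definition real_analytic_on :: "(real \<Rightarrow> real) \<Rightarrow> real set \<Rightarrow> bool" where
  "real_analytic_on f X \<longleftrightarrow> (\<forall>x\<in>X. \<exists>F. (\<lambda>h. f (x + h)) has_fps_expansion F)"

definition real_analytic_diffeo :: "real set \<Rightarrow> (real \<Rightarrow> real) \<Rightarrow> bool" where
  "real_analytic_diffeo X \<phi> \<longleftrightarrow> bij_betw \<phi> X X \<and>
     real_analytic_on \<phi> X \<and> real_analytic_on (inv_into X \<phi>) X"

text \<open>The function \<open>(f / \<bar>\<phi>'\<bar>) \<circ> \<phi>\<^sup>-\<^sup>1\<close> on \<open>X\<close>, extended by zero.\<close>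

definition comp_transpose ::
    "real set \<Rightarrow> (real \<Rightarrow> real) \<Rightarrow> (real \<Rightarrow> complex) \<Rightarrow> (real \<Rightarrow> complex)" where
  "comp_transpose X \<phi> f = (\<lambda>y. if y \<in> X
     then f (inv_into X \<phi> y) / complex_of_real \<bar>deriv \<phi> (inv_into X \<phi> y)\<bar> else 0)"

definition comp_op ::
    "real set \<Rightarrow> (real \<Rightarrow> real) \<Rightarrow> ((real \<Rightarrow> complex) \<Rightarrow> complex) \<Rightarrow> ((real \<Rightarrow> complex) \<Rightarrow> complex)" where
  "comp_op X \<phi> u = (\<lambda>f. if f \<in> test_functions X then u (comp_transpose X \<phi> f) else 0)"

end

theory Submission
  imports Defs
begin

text \<open>
  If \<open>\<phi> \<circ> \<phi> = id\<close> then \<open>C\<^sub>\<phi>\<close> is a continuous involution of \<open>\<D>'(X)\<close>; its powers are \<open>id\<close> and \<open>C\<^sub>\<phi>\<close>,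
  and its Cesaro means differ from \<open>(id + C\<^sub>\<phi>) / 2\<close> by \<open>c\<^sub>n (C\<^sub>\<phi> - id)\<close> with \<open>c\<^sub>n = 0\<close> or
  \<open>c\<^sub>n = 1 / (2 n)\<close>.

  If \<open>\<phi> (\<phi> x) \<noteq> x\<close>, the map \<open>\<phi> \<circ> \<phi>\<close> is increasing, so the orbit of \<open>x\<close> under it is strictly
  monotone and tends to some \<open>p \<in> [-\<infinity>, \<infinity>]\<close>. There is a non-negative locally integrable weight \<open>g\<close>
  that tends to infinity along the orbit, uniformly for starting points between \<open>x\<close> and
  \<open>\<phi> (\<phi> x)\<close>: \<open>\<bar>y - p\<bar> powr (-1/2)\<close> if \<open>p\<close> is finite, otherwise \<open>\<bar>y\<bar>\<close>. For a bump function \<open>f\<close>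
  supported between these two points, the numbers \<open>\<langle>C\<^sub>\<phi>\<^sup>m g, f\<rangle>\<close> are non-negative, and they tend to
  infinity along even \<open>m\<close> because the transpose of \<open>C\<^sub>\<phi>\<close> preserves integrals. Hence neither they
  nor their Cesaro means are bounded.
\<close>


subsection \<open>Locally convex topologies given by seminorms\<close>

text \<open>Carriers are sets of functions rather than types, so being a subspace is a predicate.
  One closure condition with two scalars matches the form of linearity in \<open>dual_space\<close>
  and \<open>continuous_linear_op\<close>.\<close>

definition fun_subspace :: "('i \<Rightarrow> complex) set \<Rightarrow> bool" where
  "fun_subspace V \<longleftrightarrow> (\<lambda>i. 0) \<in> V \<and>
     (\<forall>f\<in>V. \<forall>g\<in>V. \<forall>a b. (\<lambda>i. a * f i + b * g i) \<in> V)"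

lemma fun_subspace_zero: "fun_subspace V \<Longrightarrow> (\<lambda>i. 0) \<in> V"
  by (simp add: fun_subspace_def)

lemma fun_subspace_lin:
  "fun_subspace V \<Longrightarrow> f \<in> V \<Longrightarrow> g \<in> V \<Longrightarrow> (\<lambda>i. a * f i + b * g i) \<in> V"
  by (simp add: fun_subspace_def)

lemma fun_subspace_diff:
  assumes "fun_subspace V" "f \<in> V" "g \<in> V" shows "(\<lambda>i. f i - g i) \<in> V"
  using fun_subspace_lin[OF assms, of 1 "-1"] by simp

lemma fun_subspace_scale:
  assumes "fun_subspace V" "f \<in> V" shows "(\<lambda>i. c * f i) \<in> V"
  using fun_subspace_lin[OF assms(1) assms(2) assms(2), of c 0] by simp

definition linear_on :: "('i \<Rightarrow> complex) set \<Rightarrow> (('i \<Rightarrow> complex) \<Rightarrow> ('j \<Rightarrow> complex)) \<Rightarrow> bool" where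
  "linear_on V R \<longleftrightarrow> (\<forall>f\<in>V. \<forall>g\<in>V. \<forall>a b.
     R (\<lambda>i. a * f i + b * g i) = (\<lambda>j. a * R f j + b * R g j))"

lemma linear_on_lin:
  "linear_on V R \<Longrightarrow> f \<in> V \<Longrightarrow> g \<in> V \<Longrightarrow>
     R (\<lambda>i. a * f i + b * g i) = (\<lambda>j. a * R f j + b * R g j)"
  by (simp add: linear_on_def)

lemma linear_on_add:
  "linear_on V R \<Longrightarrow> f \<in> V \<Longrightarrow> g \<in> V \<Longrightarrow> R (\<lambda>i. f i + g i) = (\<lambda>j. R f j + R g j)"
  using linear_on_lin[of V R f g 1 1] by simp

lemma linear_on_diff:
  "linear_on V R \<Longrightarrow> f \<in> V \<Longrightarrow> g \<in> V \<Longrightarrow> R (\<lambda>i. f i - g i) = (\<lambda>j. R f j - R g j)"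
  using linear_on_lin[of V R f g 1 "-1"] by simp

lemma linear_on_scale:
  "linear_on V R \<Longrightarrow> f \<in> V \<Longrightarrow> R (\<lambda>i. c * f i) = (\<lambda>j. c * R f j)"
  using linear_on_lin[of V R f f c 0] by simp

lemma continuous_linear_op_iff:
  "continuous_linear_op E T \<longleftrightarrow> continuous_map E E T \<and> linear_on (topspace E) T"
  by (simp add: continuous_linear_op_def linear_on_def)

lemma seminorm_on_scale:
  "seminorm_on V p \<Longrightarrow> f \<in> V \<Longrightarrow> p (\<lambda>i. c * f i) = cmod c * p f"
  by (simp add: seminorm_on_def)

lemma seminorm_on_add:
  "seminorm_on V p \<Longrightarrow> f \<in> V \<Longrightarrow> g \<in> V \<Longrightarrow> p (\<lambda>i. f i + g i) \<le> p f + p g"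
  by (simp add: seminorm_on_def)

text \<open>\<open>seminorm_on\<close> does not list non-negativity; it follows from 0 = p (f - f)
  \<le> 2 p f.\<close>

lemma seminorm_on_nonneg:
  assumes "fun_subspace V" "seminorm_on V p" "f \<in> V" shows "p f \<ge> 0"
proof -
  have m: "(\<lambda>i. - 1 * f i) \<in> V" by (rule fun_subspace_scale[OF assms(1,3)])
  have "p (\<lambda>i. f i + - 1 * f i) \<le> p f + p (\<lambda>i. - 1 * f i)"
    by (rule seminorm_on_add[OF assms(2,3) m])
  moreover have "p (\<lambda>i. - 1 * f i) = p f"
    using seminorm_on_scale[OF assms(2,3), of "-1"] by simp
  moreover have "p (\<lambda>i. 0 * f i) = 0"
    using seminorm_on_scale[OF assms(2,3), of 0] by simp
  ultimately show ?thesis by simp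
qed

lemma seminorm_on_zero:
  assumes "fun_subspace V" "seminorm_on V p" shows "p (\<lambda>i. 0) = 0"
  using seminorm_on_scale[OF assms(2) fun_subspace_zero[OF assms(1)], of 0] by simp

lemma seminorm_on_diff_le:
  assumes "fun_subspace V" "seminorm_on V p" "f \<in> V" "g \<in> V"
  shows "\<bar>p f - p g\<bar> \<le> p (\<lambda>i. f i - g i)"
proof -
  have d: "(\<lambda>i. f i - g i) \<in> V" by (rule fun_subspace_diff) fact+
  have "p (\<lambda>i. (f i - g i) + g i) \<le> p (\<lambda>i. f i - g i) + p g"
    using seminorm_on_add[OF assms(2) d assms(4)] by simp
  moreover have "p (\<lambda>i. -1 * (f i - g i) + f i) \<le> p (\<lambda>i. -1 * (f i - g i)) + p f"
    by (rule seminorm_on_add[OF assms(2) fun_subspace_scale[OF assms(1) d] assms(3)])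
  moreover have "p (\<lambda>i. -1 * (f i - g i)) = p (\<lambda>i. f i - g i)"
    using seminorm_on_scale[OF assms(2) d, of "-1"] by simp
  ultimately show ?thesis by simp
qed

lemma seminorm_on_functional:
  assumes "\<And>f g a b. f \<in> V \<Longrightarrow> g \<in> V \<Longrightarrow> u (\<lambda>i. a * f i + b * g i) = a * u f + b * u g"
  shows "seminorm_on V (\<lambda>f. cmod (u f))"
  unfolding seminorm_on_def
proof (intro conjI ballI allI)
  fix f g assume "f \<in> V" "g \<in> V"
  then show "cmod (u (\<lambda>i. f i + g i)) \<le> cmod (u f) + cmod (u g)"
    using assms[of f g 1 1] by (simp add: norm_triangle_ineq)
next
  fix f c assume "f \<in> V"
  then show "cmod (u (\<lambda>i. c * f i)) = cmod c * cmod (u f)"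
    using assms[of f f c 0] by (simp add: norm_mult)
qed

text \<open>When \<open>q\<close> and the members of \<open>P\<close> are seminorms, this is
  continuity of \<open>q\<close> at zero in \<open>lc_topology V P\<close>. A finite set
  \<open>F\<close> appears because \<open>P\<close> need not be directed.\<close>

definition continuous_at_zero ::
    "('i \<Rightarrow> complex) set \<Rightarrow> (('i \<Rightarrow> complex) \<Rightarrow> real) set \<Rightarrow> (('i \<Rightarrow> complex) \<Rightarrow> real) \<Rightarrow> bool" where
  "continuous_at_zero V P q \<longleftrightarrow> (\<forall>e>0. \<exists>F d. finite F \<and> F \<subseteq> P \<and> d > 0 \<and>
     (\<forall>f\<in>V. (\<forall>p\<in>F. p f < d) \<longrightarrow> q f < e))"

lemma continuous_at_zeroI_sum:
  assumes I: "finite I" and p: "\<And>k. k \<in> I \<Longrightarrow> p k \<in> P" and c: "\<And>k. k \<in> I \<Longrightarrow> c k \<ge> 0"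
    and le: "\<And>f. f \<in> V \<Longrightarrow> q f \<le> (\<Sum>k\<in>I. c k * p k f)"
  shows "continuous_at_zero V P q"
  unfolding continuous_at_zero_def
proof (intro allI impI)
  fix e :: real assume e: "e > 0"
  \<comment> \<open>The summand 1 keeps the denominator positive when all coefficients vanish and
    makes the final estimate strict.\<close>
  define d where "d = e / (1 + sum c I)"
  have s: "sum c I \<ge> 0" using c by (simp add: sum_nonneg)
  have d: "d > 0" using e s by (simp add: d_def)
  have "q f < e" if f: "f \<in> V" and lt: "\<forall>r\<in>p ` I. r f < d" for f
  proof -
    have "q f \<le> (\<Sum>k\<in>I. c k * p k f)" by (rule le[OF f])
    also have "\<dots> \<le> (\<Sum>k\<in>I. c k * d)"
      using lt c by (intro sum_mono mult_left_mono) (auto intro: less_imp_le)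
    also have "\<dots> = sum c I * d" by (simp add: sum_distrib_right)
    also have "\<dots> < (1 + sum c I) * d" using d by simp
    also have "\<dots> = e" using s by (simp add: d_def)
    finally show ?thesis .
  qed
  then show "\<exists>F d. finite F \<and> F \<subseteq> P \<and> d > 0 \<and> (\<forall>f\<in>V. (\<forall>p\<in>F. p f < d) \<longrightarrow> q f < e)"
    using I p d by (intro exI[of _ "p ` I"] exI[of _ d]) auto
qed

lemma continuous_at_zeroI_member: "p \<in> P \<Longrightarrow> continuous_at_zero V P p"
  using continuous_at_zeroI_sum[of "{()}" "\<lambda>_. p" P "\<lambda>_. 1" V p] by simp

lemma continuous_at_zero_finite:
  assumes "finite G" "\<And>q. q \<in> G \<Longrightarrow> continuous_at_zero V P q" "(e::real) > 0"
  shows "\<exists>F d. finite F \<and> F \<subseteq> P \<and> d > 0 \<and> (\<forall>f\<in>V. (\<forall>p\<in>F. p f < d) \<longrightarrow> (\<forall>q\<in>G. q f < e))"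
  using assms(1,2)
proof (induction G rule: finite_induct)
  case empty
  then show ?case by (intro exI[of _ "{}"] exI[of _ 1]) simp
next
  case (insert q G)
  then obtain F d where F: "finite F" "F \<subseteq> P" "d > 0"
      "\<forall>f\<in>V. (\<forall>p\<in>F. p f < d) \<longrightarrow> (\<forall>q\<in>G. q f < e)" by auto
  obtain F' d' where F': "finite F'" "F' \<subseteq> P" "d' > 0" "\<forall>f\<in>V. (\<forall>p\<in>F'. p f < d') \<longrightarrow> q f < e"
    using insert.prems[of q] assms(3) unfolding continuous_at_zero_def by blast
  show ?case
    using F F' by (intro exI[of _ "F \<union> F'"] exI[of _ "min d d'"]) auto
qed

text \<open>Since R g - R f = R (g - f), continuity at an arbitrary point reduces to continuity at
  zero of the seminorms pulled back along \<open>R\<close>.\<close>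

lemma continuous_map_lc_topology:
  assumes V: "fun_subspace V" and R: "R \<in> V \<rightarrow> W" "linear_on V R"
    and q: "\<And>q. q \<in> Q \<Longrightarrow> continuous_at_zero V P (\<lambda>f. q (R f))"
  shows "continuous_map (lc_topology V P) (lc_topology W Q) R"
  unfolding continuous_map topspace_lc_topology
proof (intro conjI allI impI)
  show "R ` V \<subseteq> W" using R(1) by blast
  fix U assume "openin (lc_topology W Q) U"
  then have U: "\<And>f. f \<in> U \<Longrightarrow> \<exists>F e. finite F \<and> F \<subseteq> Q \<and> e > 0 \<and>
        {g \<in> W. \<forall>p\<in>F. p (\<lambda>i. g i - f i) < e} \<subseteq> U"
    unfolding openin_lc_topology by blast
  show "openin (lc_topology V P) {x \<in> V. R x \<in> U}"
    unfolding openin_lc_topology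
  proof (intro conjI ballI)
    fix f assume "f \<in> {x \<in> V. R x \<in> U}"
    then have f: "f \<in> V" "R f \<in> U" by auto
    obtain G e where G: "finite G" "G \<subseteq> Q" "e > 0"
        "{g \<in> W. \<forall>p\<in>G. p (\<lambda>i. g i - R f i) < e} \<subseteq> U" using U[OF f(2)] by blast
    have "\<exists>F d. finite F \<and> F \<subseteq> P \<and> d > 0 \<and>
        (\<forall>f\<in>V. (\<forall>p\<in>F. p f < d) \<longrightarrow> (\<forall>q\<in>(\<lambda>q f. q (R f)) ` G. q f < e))"
      by (rule continuous_at_zero_finite) (use G q in auto)
    then obtain F d where F: "finite F" "F \<subseteq> P" "d > 0"
        "\<forall>f\<in>V. (\<forall>p\<in>F. p f < d) \<longrightarrow> (\<forall>q\<in>(\<lambda>q f. q (R f)) ` G. q f < e)"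
      by blast
    have "{g \<in> V. \<forall>p\<in>F. p (\<lambda>i. g i - f i) < d} \<subseteq> {x \<in> V. R x \<in> U}"
    proof safe
      fix g assume g: "g \<in> V" "\<forall>p\<in>F. p (\<lambda>i. g i - f i) < d"
      have "\<forall>q\<in>G. q (R (\<lambda>i. g i - f i)) < e"
        using F(4) fun_subspace_diff[OF V g(1) f(1)] g(2) by auto
      then show "R g \<in> U"
        using G(4) R(1) g(1) unfolding linear_on_diff[OF R(2) g(1) f(1)] by blast
    qed
    then show "\<exists>F e. finite F \<and> F \<subseteq> P \<and> e > 0 \<and>
        {g \<in> V. \<forall>p\<in>F. p (\<lambda>i. g i - f i) < e} \<subseteq> {x \<in> V. R x \<in> U}"
      using F by blast
  qed auto
qed

text \<open>One argument for real-valued seminorms and complex functionals: in both cases the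
  distance of two values is controlled by a seminorm of the difference.\<close>

lemma continuous_map_lc_topology_euclidean:
  fixes h :: "('i \<Rightarrow> complex) \<Rightarrow> 'b::metric_space"
  assumes V: "fun_subspace V" and q: "continuous_at_zero V P q"
    and le: "\<And>f g. f \<in> V \<Longrightarrow> g \<in> V \<Longrightarrow> dist (h g) (h f) \<le> q (\<lambda>i. g i - f i)"
  shows "continuous_map (lc_topology V P) euclidean h"
  unfolding continuous_map topspace_lc_topology
proof (intro conjI allI impI)
  show "h ` V \<subseteq> topspace euclidean" by simp
  fix U :: "'b set" assume "openin euclidean U"
  then have U: "open U" by simp
  show "openin (lc_topology V P) {x \<in> V. h x \<in> U}"
    unfolding openin_lc_topology
  proof (intro conjI ballI)
    fix f assume "f \<in> {x \<in> V. h x \<in> U}"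
    then have f: "f \<in> V" "h f \<in> U" by auto
    obtain e where e: "e > 0" "\<And>y. dist y (h f) < e \<Longrightarrow> y \<in> U"
      using U f(2) unfolding open_dist by blast
    obtain F d where F: "finite F" "F \<subseteq> P" "d > 0" "\<forall>f\<in>V. (\<forall>p\<in>F. p f < d) \<longrightarrow> q f < e"
      using q[unfolded continuous_at_zero_def, rule_format, OF e(1)] by blast
    have "{g \<in> V. \<forall>p\<in>F. p (\<lambda>i. g i - f i) < d} \<subseteq> {x \<in> V. h x \<in> U}"
    proof safe
      fix g assume g: "g \<in> V" "\<forall>p\<in>F. p (\<lambda>i. g i - f i) < d"
      have "q (\<lambda>i. g i - f i) < e" using F(4) fun_subspace_diff[OF V g(1) f(1)] g(2) by auto
      then show "h g \<in> U" using le[OF f(1) g(1)] by (intro e(2)) linarith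
    qed
    then show "\<exists>F e. finite F \<and> F \<subseteq> P \<and> e > 0 \<and>
        {g \<in> V. \<forall>p\<in>F. p (\<lambda>i. g i - f i) < e} \<subseteq> {x \<in> V. h x \<in> U}"
      using F by blast
  qed auto
qed

lemma continuous_map_seminorm:
  assumes "fun_subspace V" "seminorm_on V p" "continuous_at_zero V P p"
  shows "continuous_map (lc_topology V P) euclideanreal p"
  using assms(1,3)
  by (rule continuous_map_lc_topology_euclidean)
    (use seminorm_on_diff_le[OF assms(1,2)] in \<open>simp add: dist_real_def\<close>)

lemma continuous_map_functional:
  fixes u :: "('i \<Rightarrow> complex) \<Rightarrow> complex"
  assumes "fun_subspace V"
    and u: "\<And>f g a b. f \<in> V \<Longrightarrow> g \<in> V \<Longrightarrow> u (\<lambda>i. a * f i + b * g i) = a * u f + b * u g"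
    and "continuous_at_zero V P (\<lambda>f. cmod (u f))"
  shows "continuous_map (lc_topology V P) euclidean u"
  using assms(1,3)
  by (rule continuous_map_lc_topology_euclidean) (use u[of _ _ 1 "-1"] in \<open>simp add: dist_norm\<close>)

lemma zero_nhd_lc_topology_ball:
  assumes V: "fun_subspace V" and p: "seminorm_on V p" "p \<in> P" and e: "e > 0"
  shows "zero_nhd (lc_topology V P) {f \<in> V. p f < e}"
proof -
  have "openin (lc_topology V P) {f \<in> V. p f < e}"
    using openin_continuous_map_preimage[OF continuous_map_seminorm[OF V p(1)
        continuous_at_zeroI_member[OF p(2)]], of "{..<e}"] by simp
  then show ?thesis
    using e by (simp add: zero_nhd_def fun_subspace_zero[OF V] seminorm_on_zero[OF V p(1)])
qed

lemma zero_nhd_lc_topologyE: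
  assumes "zero_nhd (lc_topology V P) U"
  obtains F e where "finite F" "F \<subseteq> P" "e > 0" "{f \<in> V. \<forall>p\<in>F. p f < e} \<subseteq> U"
proof -
  have U: "(\<lambda>i. 0) \<in> U" "openin (lc_topology V P) U" using assms by (simp_all add: zero_nhd_def)
  have "\<exists>F e. finite F \<and> F \<subseteq> P \<and> e > 0 \<and> {g \<in> V. \<forall>p\<in>F. p (\<lambda>i. g i - 0) < e} \<subseteq> U"
    by (rule bspec[OF conjunct2[OF U(2)[unfolded openin_lc_topology]] U(1)])
  then show thesis using that by auto
qed

text \<open>A converse to \<open>continuous_map_lc_topology\<close>: the preimage under
  \<open>R\<close> of a ball of \<open>p\<close> is a neighbourhood of zero and so contains a basic
  one.\<close>

lemma continuous_at_zero_compose: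
  assumes V: "fun_subspace V" and P: "\<And>p. p \<in> P \<Longrightarrow> seminorm_on V p"
    and R: "continuous_linear_op (lc_topology V P) R" and p: "p \<in> P"
  shows "continuous_at_zero V P (\<lambda>f. p (R f))"
  unfolding continuous_at_zero_def
proof (intro allI impI)
  fix e :: real assume e: "e > 0"
  let ?E = "lc_topology V P"
  have lin: "linear_on V R" and R': "continuous_map ?E ?E R"
    using R by (simp_all add: continuous_linear_op_iff)
  have "zero_nhd ?E {f \<in> V. p f < e}" by (rule zero_nhd_lc_topology_ball) (fact V P[OF p] p e)+
  then have "zero_nhd ?E {f \<in> topspace ?E. R f \<in> {f \<in> V. p f < e}}"
    using openin_continuous_map_preimage[OF R', of "{f \<in> V. p f < e}"]
      linear_on_scale[OF lin fun_subspace_zero[OF V], of 0] fun_subspace_zero[OF V]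
    by (simp add: zero_nhd_def)
  then show "\<exists>F d. finite F \<and> F \<subseteq> P \<and> d > 0 \<and> (\<forall>f\<in>V. (\<forall>p\<in>F. p f < d) \<longrightarrow> p (R f) < e)"
    by (elim zero_nhd_lc_topologyE) (intro exI conjI, assumption+, auto)
qed

text \<open>Provides the continuity of (id + T) / 2, the limit of the Cesaro means of an involution,
  and of T - id, which measures the error.\<close>

lemma continuous_linear_op_combination:
  assumes V: "fun_subspace V" and P: "\<And>p. p \<in> P \<Longrightarrow> seminorm_on V p"
    and R: "continuous_linear_op (lc_topology V P) R"
  shows "continuous_linear_op (lc_topology V P) (\<lambda>f i. a * f i + b * R f i)"
  unfolding continuous_linear_op_iff topspace_lc_topology
proof
  let ?E = "lc_topology V P"
  have lin: "linear_on V R" and R': "continuous_map ?E ?E R"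
    using R by (simp_all add: continuous_linear_op_iff)
  have RV: "R f \<in> V" if "f \<in> V" for f using R' that by (auto simp: continuous_map)
  show lin': "linear_on V (\<lambda>f i. a * f i + b * R f i)"
    unfolding linear_on_def by (auto simp: linear_on_lin[OF lin] algebra_simps)
  show "continuous_map ?E ?E (\<lambda>f i. a * f i + b * R f i)"
  proof (rule continuous_map_lc_topology[OF V _ lin'])
    show "(\<lambda>f i. a * f i + b * R f i) \<in> V \<rightarrow> V"
      using fun_subspace_lin[OF V _ RV] by blast
    fix p assume p: "p \<in> P"
    show "continuous_at_zero V P (\<lambda>f. p (\<lambda>i. a * f i + b * R f i))"
      unfolding continuous_at_zero_def
    proof (intro allI impI)
      fix e :: real assume e: "e > 0"
      \<comment> \<open>The summand 1 makes \<open>c\<close> positive and strictly larger than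
        \<open>cmod a + cmod b\<close>.\<close>
      define c where "c = 1 + cmod a + cmod b"
      have c: "c > 0" by (simp add: c_def add_pos_nonneg)
      have "\<exists>F d. finite F \<and> F \<subseteq> P \<and> d > 0 \<and>
          (\<forall>f\<in>V. (\<forall>p\<in>F. p f < d) \<longrightarrow> (\<forall>q\<in>{p, \<lambda>f. p (R f)}. q f < e / c))"
        using continuous_at_zeroI_member[OF p] continuous_at_zero_compose[OF V P R p] e c
        by (intro continuous_at_zero_finite) auto
      moreover have "p (\<lambda>i. a * f i + b * R f i) < e"
        if f: "f \<in> V" and lt: "p f < e / c" "p (R f) < e / c" for f
      proof -
        note Pp = P[OF p]
        have "p (\<lambda>i. a * f i + b * R f i) \<le> cmod a * p f + cmod b * p (R f)"
          using seminorm_on_add[OF Pp fun_subspace_scale[OF V f, of a]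
              fun_subspace_scale[OF V RV[OF f], of b]]
          by (simp add: seminorm_on_scale[OF Pp f] seminorm_on_scale[OF Pp RV[OF f]])
        also have "\<dots> \<le> cmod a * (e / c) + cmod b * (e / c)"
          using lt by (intro add_mono mult_left_mono) auto
        also have "\<dots> < c * (e / c)"
          unfolding distrib_right[symmetric] by (rule mult_strict_right_mono) (use e c in \<open>simp_all add: c_def\<close>)
        finally show ?thesis using c by simp
      qed
      ultimately show "\<exists>F d. finite F \<and> F \<subseteq> P \<and> d > 0 \<and>
          (\<forall>f\<in>V. (\<forall>p\<in>F. p f < d) \<longrightarrow> p (\<lambda>i. a * f i + b * R f i) < e)"
        unfolding ball_simps(7) by (elim exE conjE) (intro exI conjI, assumption+, blast)
    qed
  qed
qed

lemma tvs_bounded_singleton: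
  assumes V: "fun_subspace V" and P: "\<And>p. p \<in> P \<Longrightarrow> seminorm_on V p" and f: "f \<in> V"
  shows "tvs_bounded (lc_topology V P) {f}"
  unfolding tvs_bounded_def topspace_lc_topology
proof (intro conjI allI impI)
  fix U assume "zero_nhd (lc_topology V P) U"
  then obtain F e where F: "finite F" "F \<subseteq> P" "e > 0" "{f \<in> V. \<forall>p\<in>F. p f < e} \<subseteq> U"
    by (rule zero_nhd_lc_topologyE)
  \<comment> \<open>The sum dominates each \<open>p f\<close> with \<open>p\<close> in
    \<open>F\<close>; the additional 1 yields a strict inequality.\<close>
  define r where "r = 1 + (\<Sum>p\<in>F. p f) / e"
  have nn: "p f \<ge> 0" if "p \<in> F" for p using seminorm_on_nonneg[OF V P f] F(2) that by blast
  have r: "r > 0" using nn F(3) by (simp add: r_def sum_nonneg add_pos_nonneg)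
  have "{f} \<subseteq> (\<lambda>f i. c * f i) ` U" if c: "cmod c \<ge> r" for c
  proof -
    have c0: "c \<noteq> 0" using c r by auto
    have "p (\<lambda>i. inverse c * f i) < e" if p: "p \<in> F" for p
    proof -
      have "p f \<le> (\<Sum>p\<in>F. p f)" by (rule member_le_sum[OF p]) (use nn F(1) in auto)
      also have "\<dots> < r * e" using F(3) by (simp add: r_def distrib_right)
      also have "\<dots> \<le> cmod c * e" using c F(3) by simp
      finally have "p f < cmod c * e" .
      moreover have "p (\<lambda>i. inverse c * f i) = p f / cmod c"
        using seminorm_on_scale[OF P f, of p "inverse c"] p F(2)
        by (simp add: norm_inverse divide_inverse mult.commute subset_iff)
      ultimately show ?thesis using c0 by (simp only:) (simp add: pos_divide_less_eq mult.commute)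
    qed
    then have "(\<lambda>i. inverse c * f i) \<in> U" using F(4) fun_subspace_scale[OF V f] by blast
    then show ?thesis using c0 by (auto intro!: image_eqI[of _ _ "\<lambda>i. inverse c * f i"])
  qed
  then show "\<exists>r>0. \<forall>c. r \<le> cmod c \<longrightarrow> {f} \<subseteq> (\<lambda>f i. c * f i) ` U" using r by blast
qed (use f in simp)

text \<open>The preimage of a neighbourhood of zero is again one, hence absorbs \<open>B\<close>;
  applying \<open>R\<close> to this inclusion gives the claim.\<close>

lemma tvs_bounded_image:
  assumes E: "fun_subspace (topspace E)" and R: "continuous_linear_op E R" and B: "tvs_bounded E B"
  shows "tvs_bounded E (R ` B)"
  unfolding tvs_bounded_def
proof (intro conjI allI impI)
  have R': "continuous_map E E R" and lin: "linear_on (topspace E) R"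
    using R by (simp_all add: continuous_linear_op_iff)
  show "R ` B \<subseteq> topspace E" using B R' unfolding tvs_bounded_def continuous_map by blast
  fix U assume U: "zero_nhd E U"
  let ?U = "{f \<in> topspace E. R f \<in> U}"
  have "zero_nhd E ?U"
    using U openin_continuous_map_preimage[OF R', of U] fun_subspace_zero[OF E]
      linear_on_scale[OF lin fun_subspace_zero[OF E], of 0]
    by (simp add: zero_nhd_def)
  then obtain r where r: "r > 0" "\<And>c. cmod c \<ge> r \<Longrightarrow> B \<subseteq> (\<lambda>f i. c * f i) ` ?U"
    using B unfolding tvs_bounded_def by blast
  have "R ` B \<subseteq> (\<lambda>f i. c * f i) ` U" if c: "cmod c \<ge> r" for c
  proof
    fix g assume "g \<in> R ` B"
    then obtain f where "f \<in> ?U" "g = R (\<lambda>i. c * f i)" using r(2)[OF c] by blast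
    then show "g \<in> (\<lambda>f i. c * f i) ` U" using linear_on_scale[OF lin, of f c] by blast
  qed
  then show "\<exists>r>0. \<forall>c. r \<le> cmod c \<longrightarrow> R ` B \<subseteq> (\<lambda>f i. c * f i) ` U" using r(1) by blast
qed

section \<open>The strong dual and transposed operators\<close>

lemma dual_space_lin:
  "u \<in> dual_space E \<Longrightarrow> f \<in> topspace E \<Longrightarrow> g \<in> topspace E \<Longrightarrow>
     u (\<lambda>i. a * f i + b * g i) = a * u f + b * u g"
  by (simp add: dual_space_def)

lemma dual_space_scale:
  "u \<in> dual_space E \<Longrightarrow> f \<in> topspace E \<Longrightarrow> u (\<lambda>i. c * f i) = c * u f"
  using dual_space_lin[of u E f f c 0] by simp

lemma fun_subspace_dual_space: "fun_subspace (dual_space E)"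
proof -
  have "continuous_map E euclidean (\<lambda>f. a * u f)"
    if "continuous_map E euclidean u" for a :: complex and u
    using that by (simp add: continuous_map_atin tendsto_mult)
  then show ?thesis
    unfolding fun_subspace_def dual_space_def
    by (auto intro!: continuous_map_add simp: algebra_simps)
qed

text \<open>The preimage of the unit disc under \<open>u\<close> absorbs \<open>B\<close>. This
  makes the \<open>SUP\<close> in \<open>strong_dual\<close> a genuine supremum; for an unbounded
  set of reals its value would be unspecified.\<close>

lemma dual_space_bdd_above:
  assumes E: "fun_subspace (topspace E)" and u: "u \<in> dual_space E" and B: "tvs_bounded E B"
  shows "bdd_above ((\<lambda>f. cmod (u f)) ` B)"
proof -
  let ?U = "{f \<in> topspace E. u f \<in> ball 0 1}"
  have u0: "u (\<lambda>i. 0) = 0" using dual_space_scale[OF u fun_subspace_zero[OF E], of 0] by simp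
  have "continuous_map E euclidean u" using u by (simp add: dual_space_def)
  then have "zero_nhd E ?U"
    using openin_continuous_map_preimage[of E euclidean u "ball 0 1"] fun_subspace_zero[OF E] u0
    by (simp add: zero_nhd_def)
  then obtain r where r: "r > 0" "\<And>c. cmod c \<ge> r \<Longrightarrow> B \<subseteq> (\<lambda>f i. c * f i) ` ?U"
    using B unfolding tvs_bounded_def by blast
  have "cmod (u f) \<le> r" if "f \<in> B" for f
  proof -
    obtain g where "g \<in> topspace E" "cmod (u g) < 1" "f = (\<lambda>i. of_real r * g i)"
      using r(2)[of "of_real r"] r(1) \<open>f \<in> B\<close> by auto
    then show ?thesis using r(1) by (simp add: dual_space_scale[OF u] norm_mult)
  qed
  then show ?thesis by (intro bdd_aboveI2)
qed

lemma seminorm_on_strong_dual: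
  assumes E: "fun_subspace (topspace E)" and B: "tvs_bounded E B" "B \<noteq> {}"
  shows "seminorm_on (dual_space E) (\<lambda>u. SUP f\<in>B. cmod (u f))"
  unfolding seminorm_on_def
proof (intro conjI ballI allI)
  note bdd = dual_space_bdd_above[OF E _ B(1)]
  fix u v assume u: "u \<in> dual_space E" and v: "v \<in> dual_space E"
  show "(SUP f\<in>B. cmod (u f + v f)) \<le> (SUP f\<in>B. cmod (u f)) + (SUP f\<in>B. cmod (v f))"
  proof (rule cSUP_least[OF B(2)])
    fix f assume f: "f \<in> B"
    have "cmod (u f + v f) \<le> cmod (u f) + cmod (v f)" by (rule norm_triangle_ineq)
    also have "\<dots> \<le> (SUP f\<in>B. cmod (u f)) + (SUP f\<in>B. cmod (v f))"
      by (intro add_mono cSUP_upper bdd u v f)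
    finally show "cmod (u f + v f) \<le> \<dots>" .
  qed
next
  fix u c assume u: "u \<in> dual_space E"
  note bdd = dual_space_bdd_above[OF E u B(1)]
  have "(SUP f\<in>B. cmod c * cmod (u f)) = cmod c * (SUP f\<in>B. cmod (u f))"
  \<comment> \<open>The case \<open>c = 0\<close> is separate because one of the two inequalities
    divides by \<open>cmod c\<close>.\<close>
  proof (cases "c = 0")
    case False
    show ?thesis
    proof (rule antisym)
      show "(SUP f\<in>B. cmod c * cmod (u f)) \<le> cmod c * (SUP f\<in>B. cmod (u f))"
        by (intro cSUP_least[OF B(2)] mult_left_mono cSUP_upper bdd) auto
      have "bdd_above ((\<lambda>f. cmod c * cmod (u f)) ` B)"
        using bdd by (force simp: bdd_above_def intro: mult_left_mono)
      then have "cmod (u f) \<le> (SUP f\<in>B. cmod c * cmod (u f)) / cmod c" if "f \<in> B" for f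
        using cSUP_upper[OF that, of "\<lambda>f. cmod c * cmod (u f)"] False
        by (simp add: field_simps)
      then have "(SUP f\<in>B. cmod (u f)) \<le> (SUP f\<in>B. cmod c * cmod (u f)) / cmod c"
        by (intro cSUP_least[OF B(2)])
      then show "cmod c * (SUP f\<in>B. cmod (u f)) \<le> (SUP f\<in>B. cmod c * cmod (u f))"
        using False by (simp add: field_simps)
    qed
  qed (use B(2) in simp)
  then show "(SUP f\<in>B. cmod (c * u f)) = cmod c * (SUP f\<in>B. cmod (u f))"
    by (simp add: norm_mult)
qed

lemma topspace_strong_dual [simp]: "topspace (strong_dual E) = dual_space E"
  by (simp add: strong_dual_def)

text \<open>The zero branch keeps the result in \<open>dual_space E\<close>, whose members vanish
  off the carrier. \<open>comp_op X \<phi>\<close> is the instance given by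
  \<open>comp_transpose X \<phi>\<close>.\<close>

definition transpose_op ::
    "('i \<Rightarrow> complex) topology \<Rightarrow> (('i \<Rightarrow> complex) \<Rightarrow> ('i \<Rightarrow> complex)) \<Rightarrow>
     (('i \<Rightarrow> complex) \<Rightarrow> complex) \<Rightarrow> (('i \<Rightarrow> complex) \<Rightarrow> complex)" where
  "transpose_op E R u = (\<lambda>f. if f \<in> topspace E then u (R f) else 0)"

lemma transpose_op_in_dual_space:
  assumes E: "fun_subspace (topspace E)" and R: "continuous_linear_op E R" and u: "u \<in> dual_space E"
  shows "transpose_op E R u \<in> dual_space E"
proof -
  have R': "continuous_map E E R" and lin: "linear_on (topspace E) R"
    using R by (simp_all add: continuous_linear_op_iff)
  have RV: "R f \<in> topspace E" if "f \<in> topspace E" for f using R' that by (auto simp: continuous_map)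
  have "continuous_map E euclidean (u \<circ> R)"
    using u by (intro continuous_map_compose[OF R']) (simp add: dual_space_def)
  then have "continuous_map E euclidean (transpose_op E R u)"
    by (rule continuous_map_eq) (simp add: transpose_op_def)
  then show ?thesis
    unfolding dual_space_def
    by (auto simp: transpose_op_def fun_subspace_lin[OF E] linear_on_lin[OF lin]
        dual_space_lin[OF u] RV)
qed

text \<open>The supremum of the transposed functional over \<open>B\<close> is the supremum of the
  original one over the image of \<open>B\<close> under \<open>R\<close>. That image is bounded, so
  each defining seminorm is pulled back to a defining seminorm.\<close>

lemma continuous_linear_op_transpose_op:
  assumes E: "fun_subspace (topspace E)" and R: "continuous_linear_op E R"
  shows "continuous_linear_op (strong_dual E) (transpose_op E R)"
  unfolding continuous_linear_op_iff topspace_strong_dual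
proof
  show lin: "linear_on (dual_space E) (transpose_op E R)"
    unfolding linear_on_def by (auto simp: transpose_op_def)
  show "continuous_map (strong_dual E) (strong_dual E) (transpose_op E R)"
    unfolding strong_dual_def
  proof (rule continuous_map_lc_topology[OF fun_subspace_dual_space _ lin])
    show "transpose_op E R \<in> dual_space E \<rightarrow> dual_space E"
      using transpose_op_in_dual_space[OF E R] by blast
    fix q assume "q \<in> {\<lambda>u. SUP f\<in>B. cmod (u f) |B. tvs_bounded E B \<and> B \<noteq> {}}"
    then obtain B where B: "tvs_bounded E B" "B \<noteq> {}" and q: "q = (\<lambda>u. SUP f\<in>B. cmod (u f))"
      by blast
    have "B \<subseteq> topspace E" using B(1) by (simp add: tvs_bounded_def)
    then have "q (transpose_op E R u) = (SUP f\<in>R ` B. cmod (u f))" for u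
      unfolding q image_image transpose_op_def by (intro SUP_cong) auto
    then show "continuous_at_zero (dual_space E)
        {\<lambda>u. SUP f\<in>B. cmod (u f) |B. tvs_bounded E B \<and> B \<noteq> {}} (\<lambda>u. q (transpose_op E R u))"
      using B tvs_bounded_image[OF E R B(1)] by (auto intro!: continuous_at_zeroI_member)
  qed
qed

lemma seminorm_on_strong_dual_family:
  assumes "fun_subspace (topspace E)"
    and "q \<in> {\<lambda>u. SUP f\<in>B. cmod (u f) |B. tvs_bounded E B \<and> B \<noteq> {}}"
  shows "seminorm_on (dual_space E) q"
  using seminorm_on_strong_dual[OF assms(1)] assms(2) by blast

text \<open>With \<open>B = {f}\<close> the modulus of the value at \<open>f\<close> is itself a
  defining seminorm. Evaluations turn statements about operators into statements about number
  sequences.\<close>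

lemma continuous_map_evaluation:
  assumes E: "fun_subspace (topspace E)" and f: "tvs_bounded E {f}"
  shows "continuous_map (strong_dual E) euclidean (\<lambda>u. u f)"
  unfolding strong_dual_def
proof (rule continuous_map_functional[OF fun_subspace_dual_space])
  show "continuous_at_zero (dual_space E)
      {\<lambda>u. SUP f\<in>B. cmod (u f) |B. tvs_bounded E B \<and> B \<noteq> {}} (\<lambda>u. cmod (u f))"
    using f by (intro continuous_at_zeroI_member CollectI exI[of _ "{f}"]) auto
qed simp

subsection \<open>Test functions\<close>

lemma nth_deriv_0 [simp]: "nth_deriv 0 f = f"
  by (simp add: nth_deriv_def)

lemma nth_deriv_Suc: "nth_deriv (Suc n) f = (\<lambda>x. vector_derivative (nth_deriv n f) (at x))"
  by (simp add: nth_deriv_def)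

lemma smooth_nth_deriv:
  assumes "smooth f"
  shows "(nth_deriv n f has_vector_derivative nth_deriv (Suc n) f x) (at x)"
  using assms by (simp add: smooth_def nth_deriv_Suc vector_derivative_works[symmetric])

lemma continuous_on_nth_deriv: "smooth f \<Longrightarrow> continuous_on A (nth_deriv n f)"
  by (intro continuous_at_imp_continuous_on ballI)
    (rule has_vector_derivative_continuous[OF smooth_nth_deriv])

text \<open>\<open>nth_deriv\<close> iterates \<open>vector_derivative\<close>, which says nothing
  until differentiability is known. A sequence of functions, each the derivative of the one before,
  settles the values here and smoothness in \<open>smoothI\<close>.\<close>

lemma nth_deriv_eqI:
  assumes "R 0 = f" "\<And>n x. (R n has_vector_derivative R (Suc n) x) (at x)"
  shows "nth_deriv n f = R n"
proof (induction n)
  case (Suc n)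
  have "vector_derivative (R n) (at x) = R (Suc n) x" for x
    by (rule vector_derivative_at) (rule assms(2))
  then show ?case unfolding nth_deriv_Suc Suc.IH by blast
qed (simp add: assms(1))

lemma smoothI:
  assumes "R 0 = f" "\<And>n x. (R n has_vector_derivative R (Suc n) x) (at x)"
  shows "smooth f"
  unfolding smooth_def nth_deriv_eqI[of R, OF assms]
  using assms(2) differentiableI_vector by blast

text \<open>Membership in a class closed under differentiation suffices: iterating a choice of
  derivatives inside the class gives the sequence that \<open>smoothI\<close> asks for.\<close>

lemma smooth_coinduct:
  assumes "f \<in> C" and "\<And>f. f \<in> C \<Longrightarrow> \<exists>f'\<in>C. \<forall>x. (f has_vector_derivative f' x) (at x)"
  shows "smooth f"
proof -
  obtain d where d: "\<And>f. f \<in> C \<Longrightarrow> d f \<in> C \<and> (\<forall>x. (f has_vector_derivative d f x) (at x))"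
    using assms(2) by metis
  have C: "(d ^^ n) f \<in> C" for n by (induction n) (use assms(1) d in auto)
  show ?thesis by (rule smoothI[of "\<lambda>n. (d ^^ n) f"]) (use d C in auto)
qed

lemma smooth_lin:
  assumes f: "smooth f" and g: "smooth g"
  shows "smooth (\<lambda>x. a * f x + b * g x)"
proof (rule smoothI[of "\<lambda>n x. a * nth_deriv n f x + b * nth_deriv n g x"])
  show "((\<lambda>x. a * nth_deriv n f x + b * nth_deriv n g x) has_vector_derivative
      a * nth_deriv (Suc n) f x + b * nth_deriv (Suc n) g x) (at x)" for n x
    by (intro derivative_intros smooth_nth_deriv f g)
qed simp

lemma nth_deriv_eq_0_outside:
  assumes "smooth f" "closed K" "\<And>x. x \<notin> K \<Longrightarrow> f x = 0" "x \<notin> K"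
  shows "nth_deriv n f x = 0"
  using assms(4)
proof (induction n arbitrary: x)
  case (Suc n)
  have "((\<lambda>_. 0) has_vector_derivative nth_deriv (Suc n) f x) (at x)"
    by (rule has_vector_derivative_transform_within_open[OF smooth_nth_deriv[OF assms(1)],
          where S = "- K"]) (use assms(2) Suc in auto)
  then show ?case by (rule vector_derivative_unique_at) simp
qed (simp add: assms(3))

text \<open>The support is closed by definition, so once it lies in the compact set \<open>K\<close>
  its compactness is automatic.\<close>

lemma test_functions_compact_iff:
  assumes "compact K"
  shows "f \<in> test_functions K \<longleftrightarrow> smooth f \<and> (\<forall>x. x \<notin> K \<longrightarrow> f x = 0)"
proof -
  have "closure {x. f x \<noteq> 0} \<subseteq> K" if "\<forall>x. x \<notin> K \<longrightarrow> f x = 0"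
    by (rule closure_minimal) (use that assms compact_imp_closed in auto)
  then have "closure {x. f x \<noteq> 0} \<subseteq> K \<longleftrightarrow> (\<forall>x. x \<notin> K \<longrightarrow> f x = 0)"
    using closure_subset[of "{x. f x \<noteq> 0}"] by blast
  moreover have "compact (closure {x. f x \<noteq> 0})" if "closure {x. f x \<noteq> 0} \<subseteq> K"
    using compact_Int_closed[OF assms closed_closure, of "{x. f x \<noteq> 0}"] that
    by (simp add: Int_absorb1)
  ultimately show ?thesis unfolding test_functions_def by blast
qed

lemma test_functions_iff:
  "f \<in> test_functions X \<longleftrightarrow> (\<exists>K. compact K \<and> K \<subseteq> X \<and> f \<in> test_functions K)"
  unfolding test_functions_def by blast

lemma test_functions_mono: "X \<subseteq> Y \<Longrightarrow> test_functions X \<subseteq> test_functions Y"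
  unfolding test_functions_def by blast

lemma test_functionsE:
  assumes "f \<in> test_functions X"
  obtains K where "compact K" "K \<subseteq> X" "smooth f" "\<And>x. x \<notin> K \<Longrightarrow> f x = 0"
proof -
  obtain K where K: "compact K" "K \<subseteq> X" "f \<in> test_functions K"
    using assms test_functions_iff[of f X] by blast
  then show thesis using that[OF K(1,2)] by (simp add: test_functions_compact_iff)
qed

lemma fun_subspace_test_functions: "fun_subspace (test_functions X)"
  unfolding fun_subspace_def
proof (intro conjI ballI allI)
  have "smooth (\<lambda>_. 0)" by (rule smoothI[of "\<lambda>_ _. 0"]) auto
  then show "(\<lambda>_. 0) \<in> test_functions X" by (simp add: test_functions_def)
  fix f g a b assume f: "f \<in> test_functions X" and g: "g \<in> test_functions X"
  obtain K where K: "compact K" "K \<subseteq> X" "smooth f" "\<And>x. x \<notin> K \<Longrightarrow> f x = 0"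
    using f by (rule test_functionsE) blast
  obtain L where L: "compact L" "L \<subseteq> X" "smooth g" "\<And>x. x \<notin> L \<Longrightarrow> g x = 0"
    using g by (rule test_functionsE) blast
  have "(\<lambda>x. a * f x + b * g x) \<in> test_functions (K \<union> L)"
    using K L smooth_lin by (subst test_functions_compact_iff) auto
  then show "(\<lambda>x. a * f x + b * g x) \<in> test_functions X"
    using K L by (subst test_functions_iff) (intro exI[of _ "K \<union> L"], auto)
qed

text \<open>Each derivative is continuous on the compact support and zero elsewhere. Hence the
  suprema that define \<open>DK_topology\<close> are genuine.\<close>

lemma nth_deriv_bdd_above:
  assumes "f \<in> test_functions X"
  shows "bdd_above (range (\<lambda>x. cmod (nth_deriv n f x)))"
proof -
  obtain K where K: "compact K" "smooth f" "\<And>x. x \<notin> K \<Longrightarrow> f x = 0"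
    using assms by (rule test_functionsE) blast
  have "continuous_on K (nth_deriv n f)" by (rule continuous_on_nth_deriv[OF K(2)])
  then have "bounded (nth_deriv n f ` K)"
    using K(1) compact_continuous_image compact_imp_bounded by blast
  then obtain B where B: "\<And>x. x \<in> K \<Longrightarrow> cmod (nth_deriv n f x) \<le> B"
    unfolding bounded_iff by blast
  have "nth_deriv n f x = 0" if "x \<notin> K" for x
    by (rule nth_deriv_eq_0_outside[OF K(2) compact_imp_closed[OF K(1)] K(3) that])
  then have "cmod (nth_deriv n f x) \<le> max B 0" for x
    using B[of x] by (cases "x \<in> K") (auto simp: le_max_iff_disj)
  then show ?thesis by (intro bdd_aboveI2)
qed

lemma nth_deriv_le_SUP:
  assumes "f \<in> test_functions X"
  shows "cmod (nth_deriv n f x) \<le> (SUP x. cmod (nth_deriv n f x))"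
  by (rule cSUP_upper[OF UNIV_I nth_deriv_bdd_above[OF assms]])

section \<open>The inductive limit topology on test functions\<close>

definition D_seminorms :: "real set \<Rightarrow> ((real \<Rightarrow> complex) \<Rightarrow> real) set" where
  "D_seminorms X = {p. seminorm_on (test_functions X) p \<and>
     (\<forall>K. compact K \<and> K \<subseteq> X \<longrightarrow> continuous_map (DK_topology K) euclideanreal p)}"

lemma D_topology_eq: "D_topology X = lc_topology (test_functions X) (D_seminorms X)"
  by (simp add: D_topology_def D_seminorms_def)

lemma topspace_D_topology [simp]: "topspace (D_topology X) = test_functions X"
  by (simp add: D_topology_eq)

lemma seminorm_on_D_seminorms: "p \<in> D_seminorms X \<Longrightarrow> seminorm_on (test_functions X) p"
  by (simp add: D_seminorms_def)

lemma fun_subspace_D_topology: "fun_subspace (topspace (D_topology X))"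
  by (simp add: fun_subspace_test_functions)

lemma tvs_bounded_D_singleton: "f \<in> test_functions X \<Longrightarrow> tvs_bounded (D_topology X) {f}"
  unfolding D_topology_eq
  using tvs_bounded_singleton[OF fun_subspace_test_functions seminorm_on_D_seminorms] .

text \<open>On each step, p \<circ> R factors through a continuous map into another step, on which
  \<open>p\<close> is continuous. So p \<circ> R is again one of the seminorms that define the
  inductive limit.\<close>

lemma continuous_linear_op_D_topology:
  assumes R: "R \<in> test_functions X \<rightarrow> test_functions X" "linear_on (test_functions X) R"
    and K: "\<And>K. compact K \<Longrightarrow> K \<subseteq> X \<Longrightarrow>
      \<exists>L. compact L \<and> L \<subseteq> X \<and> continuous_map (DK_topology K) (DK_topology L) R"
  shows "continuous_linear_op (D_topology X) R"
  unfolding continuous_linear_op_iff topspace_D_topology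
proof
  show "continuous_map (D_topology X) (D_topology X) R"
    unfolding D_topology_eq
  proof (rule continuous_map_lc_topology[OF fun_subspace_test_functions R])
    fix p assume "p \<in> D_seminorms X"
    then have p: "seminorm_on (test_functions X) p"
      "\<And>L. compact L \<Longrightarrow> L \<subseteq> X \<Longrightarrow> continuous_map (DK_topology L) euclideanreal p"
      by (simp_all add: D_seminorms_def)
    have "(\<lambda>f. p (R f)) \<in> D_seminorms X"
      unfolding D_seminorms_def
    proof (intro CollectI conjI allI impI)
      show "seminorm_on (test_functions X) (\<lambda>f. p (R f))"
        unfolding seminorm_on_def
      proof (intro conjI ballI allI)
        fix f g c assume f: "f \<in> test_functions X"
        then have Rf: "R f \<in> test_functions X" using R(1) by blast
        show "p (R (\<lambda>i. c * f i)) = cmod c * p (R f)"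
          unfolding linear_on_scale[OF R(2) f] by (rule seminorm_on_scale[OF p(1) Rf])
        assume g: "g \<in> test_functions X"
        then have Rg: "R g \<in> test_functions X" using R(1) by blast
        show "p (R (\<lambda>i. f i + g i)) \<le> p (R f) + p (R g)"
          unfolding linear_on_add[OF R(2) f g] by (rule seminorm_on_add[OF p(1) Rf Rg])
      qed
      fix K assume "compact K \<and> K \<subseteq> X"
      then obtain L where L: "compact L" "L \<subseteq> X"
          "continuous_map (DK_topology K) (DK_topology L) R" using K by blast
      show "continuous_map (DK_topology K) euclideanreal (\<lambda>f. p (R f))"
        using continuous_map_compose[OF L(3) p(2)[OF L(1,2)]] by (simp add: o_def)
    qed
    then show "continuous_at_zero (test_functions X) (D_seminorms X) (\<lambda>f. p (R f))"
      by (rule continuous_at_zeroI_member)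
  qed
qed (fact R(2))

subsection \<open>Continuity of the transposed composition operator\<close>

text \<open>The power series represents f (x + h) for all h near 0, so it can be differentiated at 0
  and the result shifted to \<open>x\<close>.\<close>

lemma real_analytic_on_DERIV:
  assumes "real_analytic_on f X" "x \<in> X"
  shows "(f has_field_derivative deriv f x) (at x)"
proof -
  obtain F where F: "(\<lambda>h. f (x + h)) has_fps_expansion F"
    using assms unfolding real_analytic_on_def by blast
  have "(eval_fps F has_field_derivative eval_fps (fps_deriv F) 0) (at 0)"
    using F by (intro has_field_derivative_eval_fps) (simp add: has_fps_expansion_def zero_ereal_def)
  moreover have "eventually (\<lambda>h. eval_fps F h = f (x + h)) (nhds 0)"
    using F by (simp add: has_fps_expansion_def)
  ultimately have "((\<lambda>h. f (x + h)) has_field_derivative eval_fps (fps_deriv F) 0) (at 0)"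
    using DERIV_cong_ev[of 0 0 "eval_fps F" "\<lambda>h. f (x + h)"] by simp
  then have "(f has_field_derivative eval_fps (fps_deriv F) 0) (at x)"
    using DERIV_shift[of f _ 0 x] by (simp add: add.commute)
  then show ?thesis by (metis DERIV_imp_deriv)
qed

lemma real_analytic_on_deriv:
  assumes "real_analytic_on f X" shows "real_analytic_on (deriv f) X"
  unfolding real_analytic_on_def
proof
  fix x assume "x \<in> X"
  then obtain F where F: "(\<lambda>h. f (x + h)) has_fps_expansion F"
    using assms unfolding real_analytic_on_def by blast
  have "deriv (\<lambda>h. f (x + h)) = (\<lambda>h. deriv f (x + h))"
    unfolding deriv_def by (simp add: DERIV_shift[symmetric] add.commute)
  then show "\<exists>F. (\<lambda>h. deriv f (x + h)) has_fps_expansion F"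
    using has_fps_expansion_deriv[OF F] by auto
qed

lemma real_analytic_on_const: "real_analytic_on (\<lambda>_. c) X"
  unfolding real_analytic_on_def by blast

lemma real_analytic_on_add:
  "real_analytic_on f X \<Longrightarrow> real_analytic_on g X \<Longrightarrow> real_analytic_on (\<lambda>x. f x + g x) X"
  unfolding real_analytic_on_def by (metis has_fps_expansion_add)

lemma real_analytic_on_mult:
  "real_analytic_on f X \<Longrightarrow> real_analytic_on g X \<Longrightarrow> real_analytic_on (\<lambda>x. f x * g x) X"
  unfolding real_analytic_on_def by (metis has_fps_expansion_mult)

lemma real_analytic_on_continuous_on: "real_analytic_on f X \<Longrightarrow> continuous_on X f"
  by (intro continuous_at_imp_continuous_on ballI) (rule DERIV_isCont[OF real_analytic_on_DERIV])

text \<open>The coefficients in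
  \<open>(w \<cdot> (f \<circ> h))\<^sup>(\<^sup>n\<^sup>) = (\<Sum>k\<le>n. chain_coeff w h n k \<cdot> (f\<^sup>(\<^sup>k\<^sup>) \<circ> h))\<close>.\<close>

primrec chain_coeff :: "(real \<Rightarrow> real) \<Rightarrow> (real \<Rightarrow> real) \<Rightarrow> nat \<Rightarrow> nat \<Rightarrow> real \<Rightarrow> real" where
  "chain_coeff w h 0 = (\<lambda>k. if k = 0 then w else (\<lambda>_. 0))"
| "chain_coeff w h (Suc n) = (\<lambda>k y. deriv (chain_coeff w h n k) y +
     (if k = 0 then 0 else chain_coeff w h n (k - 1) y * deriv h y))"

lemma chain_coeff_eq_0: "n < k \<Longrightarrow> chain_coeff w h n k = (\<lambda>_. 0)"
proof (induction n arbitrary: k)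
  case (Suc n)
  then have "chain_coeff w h n k = (\<lambda>_. 0)" "chain_coeff w h n (k - 1) = (\<lambda>_. 0)" "k \<noteq> 0" by auto
  then show ?case by simp
qed simp

lemma real_analytic_on_chain_coeff:
  assumes "real_analytic_on w X" "real_analytic_on h X"
  shows "real_analytic_on (chain_coeff w h n k) X"
proof (induction n arbitrary: k)
  case (Suc n)
  show ?case
    using Suc[of k] Suc[of "k - 1"] assms(2)
    by (cases "k = 0") (auto intro!: real_analytic_on_add real_analytic_on_mult real_analytic_on_deriv)
qed (use assms real_analytic_on_const in auto)

text \<open>Product and chain rule, term by term. Where the derivative falls on \<open>f\<close> the
  order of its derivative rises by one, and collecting equal orders reproduces the recursion of
  \<open>chain_coeff\<close>.\<close>

lemma has_vector_derivative_chain_coeff_sum: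
  assumes w: "real_analytic_on w X" and h: "real_analytic_on h X" and f: "smooth f" and y: "y \<in> X"
  shows "((\<lambda>y. \<Sum>k\<le>n. chain_coeff w h n k y *\<^sub>R nth_deriv k f (h y)) has_vector_derivative
     (\<Sum>k\<le>Suc n. chain_coeff w h (Suc n) k y *\<^sub>R nth_deriv k f (h y))) (at y)"
proof -
  let ?A = "chain_coeff w h" and ?F = "\<lambda>k. nth_deriv k f (h y)"
  have h': "(h has_vector_derivative deriv h y) (at y)"
    using real_analytic_on_DERIV[OF h y] by (simp add: has_real_derivative_iff_has_vector_derivative)
  have "((\<lambda>y. ?A n k y *\<^sub>R nth_deriv k f (h y)) has_vector_derivative
      ?A n k y *\<^sub>R (deriv h y *\<^sub>R ?F (Suc k)) + deriv (?A n k) y *\<^sub>R ?F k) (at y)" for k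
    using vector_diff_chain_at[OF h' smooth_nth_deriv[OF f, of k]]
    by (intro has_vector_derivative_scaleR
        real_analytic_on_DERIV[OF real_analytic_on_chain_coeff[OF w h] y]) (simp add: o_def)
  then have "((\<lambda>y. \<Sum>k\<le>n. ?A n k y *\<^sub>R nth_deriv k f (h y)) has_vector_derivative
      (\<Sum>k\<le>n. ?A n k y *\<^sub>R (deriv h y *\<^sub>R ?F (Suc k)) + deriv (?A n k) y *\<^sub>R ?F k)) (at y)"
    by (intro has_vector_derivative_sum)
  \<comment> \<open>Both sums are stretched to \<open>Suc n\<close>: the first gains a vanishing top
    coefficient, the second is shifted by one index and starts with a zero term.\<close>
  also have "(\<Sum>k\<le>n. ?A n k y *\<^sub>R (deriv h y *\<^sub>R ?F (Suc k)) + deriv (?A n k) y *\<^sub>R ?F k) =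
      (\<Sum>k\<le>Suc n. deriv (?A n k) y *\<^sub>R ?F k) +
      (\<Sum>k\<le>Suc n. (if k = 0 then 0 else ?A n (k - 1) y * deriv h y) *\<^sub>R ?F k)"
    unfolding sum.atMost_Suc_shift[where n = n and
        g = "\<lambda>k. (if k = 0 then 0 else ?A n (k - 1) y * deriv h y) *\<^sub>R ?F k"]
    by (simp add: sum.distrib chain_coeff_eq_0)
  also have "\<dots> = (\<Sum>k\<le>Suc n. ?A (Suc n) k y *\<^sub>R ?F k)"
    unfolding sum.distrib[symmetric] by (intro sum.cong) (simp_all add: scaleR_add_left)
  finally show ?thesis .
qed

section \<open>The transpose of the composition operator on test functions\<close>

locale interval_diffeo =
  fixes X :: "real set" and \<phi> :: "real \<Rightarrow> real"
  assumes open_X: "open X" and interval_X: "is_interval X"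
    and diffeo: "real_analytic_diffeo X \<phi>"
begin

abbreviation \<psi> :: "real \<Rightarrow> real" where "\<psi> \<equiv> inv_into X \<phi>"
abbreviation S :: "(real \<Rightarrow> complex) \<Rightarrow> (real \<Rightarrow> complex)" where "S \<equiv> comp_transpose X \<phi>"

lemma bij: "bij_betw \<phi> X X"
  and analytic_phi: "real_analytic_on \<phi> X" and analytic_psi: "real_analytic_on \<psi> X"
  using diffeo by (auto simp: real_analytic_diffeo_def)

lemma phi_in [simp]: "x \<in> X \<Longrightarrow> \<phi> x \<in> X"
  using bij by (auto simp: bij_betw_def)

lemma psi_in [simp]: "x \<in> X \<Longrightarrow> \<psi> x \<in> X"
  using bij bij_betw_inv_into[of \<phi> X X] by (auto simp: bij_betw_def)

lemma phi_psi [simp]: "x \<in> X \<Longrightarrow> \<phi> (\<psi> x) = x"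
  using bij by (simp add: bij_betw_inv_into_right)

lemma DERIV_phi: "x \<in> X \<Longrightarrow> (\<phi> has_field_derivative deriv \<phi> x) (at x)"
  by (rule real_analytic_on_DERIV[OF analytic_phi])

lemma DERIV_psi: "x \<in> X \<Longrightarrow> (\<psi> has_field_derivative deriv \<psi> x) (at x)"
  by (rule real_analytic_on_DERIV[OF analytic_psi])

text \<open>Differentiates \<phi> \<circ> \<psi> = id, valid on the open set \<open>X\<close>. In
  particular neither derivative has a zero on \<open>X\<close>.\<close>

lemma deriv_phi_psi:
  assumes "y \<in> X" shows "deriv \<phi> (\<psi> y) * deriv \<psi> y = 1"
proof -
  have "((\<lambda>y. \<phi> (\<psi> y)) has_field_derivative deriv \<phi> (\<psi> y) * deriv \<psi> y) (at y)"
    by (rule DERIV_chain2[OF DERIV_phi DERIV_psi]) (use assms in auto)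
  moreover have "((\<lambda>y. \<phi> (\<psi> y)) has_field_derivative 1) (at y)"
    by (rule has_field_derivative_transform_within_open[OF DERIV_ident open_X assms]) simp
  ultimately show ?thesis by (rule DERIV_unique)
qed

text \<open>By the inverse function rule the factor 1 / \<bar>\<phi>'\<bar> at \<psi> y is
  \<bar>\<psi>'\<bar> at y, so the division becomes multiplication by a Jacobian.\<close>

lemma comp_transpose_eq: "S f y = (if y \<in> X then \<bar>deriv \<psi> y\<bar> *\<^sub>R f (\<psi> y) else 0)"
proof (cases "y \<in> X")
  case True
  have "\<bar>deriv \<psi> y\<bar> = 1 / \<bar>deriv \<phi> (\<psi> y)\<bar>"
    using deriv_phi_psi[OF True] by (metis abs_1 abs_mult eq_divide_eq mult.commute mult_zero_left zero_neq_one abs_eq_0)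
  then show ?thesis using True by (simp add: comp_transpose_def scaleR_conv_of_real)
qed (simp add: comp_transpose_def)

text \<open>\<psi>' is continuous without zeros on an interval, hence of constant sign. The weight
  \<bar>\<psi>'\<bar> is therefore analytic, being \<psi>' up to a constant factor.\<close>

lemma deriv_psi_sign:
  obtains s :: real where "\<And>y. y \<in> X \<Longrightarrow> \<bar>deriv \<psi> y\<bar> = s * deriv \<psi> y"
proof -
  have "continuous_on X (deriv \<psi>)"
    by (intro real_analytic_on_continuous_on real_analytic_on_deriv analytic_psi)
  then have "is_interval (deriv \<psi> ` X)"
    using interval_X by (simp add: is_interval_connected_1 connected_continuous_image)
  moreover have "0 \<notin> deriv \<psi> ` X" using deriv_phi_psi by force
  ultimately have "(\<forall>y\<in>X. deriv \<psi> y \<ge> 0) \<or> (\<forall>y\<in>X. deriv \<psi> y \<le> 0)"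
    unfolding is_interval_1 by (meson image_eqI linear)
  then show thesis
  proof
    assume "\<forall>y\<in>X. deriv \<psi> y \<ge> 0" then show thesis by (intro that[of 1]) simp
  next
    assume "\<forall>y\<in>X. deriv \<psi> y \<le> 0" then show thesis by (intro that[of "-1"]) simp
  qed
qed

lemma linear_on_S: "linear_on V S"
  unfolding linear_on_def by (auto simp: comp_transpose_eq scaleR_conv_of_real algebra_simps)

lemma compact_image_phi: "compact K \<Longrightarrow> K \<subseteq> X \<Longrightarrow> compact (\<phi> ` K)"
  by (meson analytic_phi compact_continuous_image continuous_on_subset real_analytic_on_continuous_on)

text \<open>On \<open>X\<close>, \<open>S f\<close> is an analytic weight times f \<circ> \<psi>, so
  \<open>chain_coeff\<close> applies. The coefficients do not depend on \<open>f\<close>, which is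
  what makes the continuity estimate for \<open>S\<close> possible.\<close>

lemma nth_deriv_S:
  obtains A where "\<And>n k. real_analytic_on (A n k) X"
    and "\<And>f n y. f \<in> test_functions X \<Longrightarrow> nth_deriv n (S f) y =
      (if y \<in> X then \<Sum>k\<le>n. A n k y *\<^sub>R nth_deriv k f (\<psi> y) else 0)"
    and "\<And>f. f \<in> test_functions X \<Longrightarrow> smooth (S f)"
proof -
  obtain s where s: "\<And>y. y \<in> X \<Longrightarrow> \<bar>deriv \<psi> y\<bar> = s * deriv \<psi> y" by (rule deriv_psi_sign) auto
  define w where "w = (\<lambda>y. s * deriv \<psi> y)"
  have w: "real_analytic_on w X"
    unfolding w_def by (intro real_analytic_on_mult real_analytic_on_const real_analytic_on_deriv analytic_psi)
  define A where "A = chain_coeff w \<psi>"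
  define R where "R f n y = (if y \<in> X then \<Sum>k\<le>n. A n k y *\<^sub>R nth_deriv k f (\<psi> y) else 0)" for f n y
  have R0: "R f 0 = S f" for f by (simp add: R_def A_def w_def comp_transpose_eq s fun_eq_iff)
  have R: "(R f n has_vector_derivative R f (Suc n) y) (at y)" if f: "f \<in> test_functions X" for f n y
  proof -
    obtain K where K: "compact K" "K \<subseteq> X" "smooth f" "\<And>x. x \<notin> K \<Longrightarrow> f x = 0"
      using f by (rule test_functionsE) blast
    show ?thesis
    proof (cases "y \<in> X")
      case True
      have "(R f n has_vector_derivative
          (\<Sum>k\<le>Suc n. chain_coeff w \<psi> (Suc n) k y *\<^sub>R nth_deriv k f (\<psi> y))) (at y)"
        by (rule has_vector_derivative_transform_within_open[OF
              has_vector_derivative_chain_coeff_sum[OF w analytic_psi K(3) True] open_X True])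
          (simp add: R_def A_def)
      then show ?thesis using True by (simp add: R_def A_def)
    next
      case False
      \<comment> \<open>Everything vanishes off the image of \<open>K\<close> under \<phi>, which is
        compact and contained in \<open>X\<close>. A point outside \<open>X\<close> thus has a
        neighbourhood on which the function is zero, boundary points of \<open>X\<close>
        included.\<close>
      have "R f n z = 0" if "z \<notin> \<phi> ` K" for z
      proof (cases "z \<in> X")
        case True
        then have "\<psi> z \<notin> K" using that phi_psi[OF True] by force
        then show ?thesis
          using nth_deriv_eq_0_outside[OF K(3) compact_imp_closed[OF K(1)] K(4)] by (simp add: R_def)
      qed (simp add: R_def)
      then have "(R f n has_vector_derivative 0) (at y)"
        using False K(2) compact_imp_closed[OF compact_image_phi[OF K(1,2)]]
        by (intro has_vector_derivative_transform_within_open[OF has_vector_derivative_const,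
              of "- \<phi> ` K"]) auto
      then show ?thesis using False by (simp add: R_def)
    qed
  qed
  show thesis
  proof (rule that[of A])
    show "real_analytic_on (A n k) X" for n k
      unfolding A_def by (rule real_analytic_on_chain_coeff[OF w analytic_psi])
    show "smooth (S f)" if "f \<in> test_functions X" for f
      by (rule smoothI[of "R f"]) (use R0 R that in auto)
    show "nth_deriv n (S f) y =
      (if y \<in> X then \<Sum>k\<le>n. A n k y *\<^sub>R nth_deriv k f (\<psi> y) else 0)"
      if "f \<in> test_functions X" for f n y
      using nth_deriv_eqI[of "R f" "S f" n] R0 R that by (simp add: R_def)
  qed
qed

lemma S_eq_0: "(\<And>x. x \<notin> K \<Longrightarrow> f x = 0) \<Longrightarrow> y \<notin> \<phi> ` K \<Longrightarrow> S f y = 0"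
  unfolding comp_transpose_eq by (metis image_eqI phi_psi scaleR_zero_right)

lemma S_test_functions_compact:
  assumes "compact K" "K \<subseteq> X" "f \<in> test_functions K"
  shows "S f \<in> test_functions (\<phi> ` K)"
proof -
  have "f \<in> test_functions X" using assms(2,3) test_functions_mono by blast
  then have "smooth (S f)" using nth_deriv_S by metis
  then show ?thesis
    using assms compact_image_phi[OF assms(1,2)] S_eq_0[of K f]
    by (simp add: test_functions_compact_iff)
qed

lemma S_test_functions: "f \<in> test_functions X \<Longrightarrow> S f \<in> test_functions X"
  using S_test_functions_compact test_functions_iff
  by (metis compact_image_phi image_subsetI phi_in subsetD)

text \<open>The analytic coefficients of the n-th derivative of \<open>S f\<close> are bounded on
  the compact image of \<open>K\<close>, so that derivative is dominated by finitely many seminorms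
  of \<open>f\<close>.\<close>

lemma continuous_map_DK_S:
  assumes K: "compact K" "K \<subseteq> X"
  shows "continuous_map (DK_topology K) (DK_topology (\<phi> ` K)) S"
  unfolding DK_topology_def
proof (rule continuous_map_lc_topology[OF fun_subspace_test_functions _ linear_on_S])
  show "S \<in> test_functions K \<rightarrow> test_functions (\<phi> ` K)" using S_test_functions_compact[OF K] by blast
  fix q :: "(real \<Rightarrow> complex) \<Rightarrow> real" assume "q \<in> {\<lambda>f. SUP x. cmod (nth_deriv n f x) |n. True}"
  then obtain n where q: "q = (\<lambda>f. SUP x. cmod (nth_deriv n f x))" by blast
  obtain A where A: "\<And>n k. real_analytic_on (A n k) X"
      "\<And>f n y. f \<in> test_functions X \<Longrightarrow> nth_deriv n (S f) y =
        (if y \<in> X then \<Sum>k\<le>n. A n k y *\<^sub>R nth_deriv k f (\<psi> y) else 0)"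
      "\<And>f. f \<in> test_functions X \<Longrightarrow> smooth (S f)"
    by (rule nth_deriv_S) blast
  have "\<exists>M\<ge>0. \<forall>y\<in>\<phi> ` K. \<bar>A n k y\<bar> \<le> M" for k
  proof -
    have "continuous_on (\<phi> ` K) (A n k)"
      by (rule continuous_on_subset[OF real_analytic_on_continuous_on[OF A(1)]]) (use K(2) in auto)
    then have "bounded (A n k ` \<phi> ` K)"
      by (intro compact_imp_bounded compact_continuous_image compact_image_phi K)
    then obtain M where "\<forall>y\<in>\<phi> ` K. \<bar>A n k y\<bar> \<le> M" unfolding bounded_iff by auto
    then show ?thesis by (intro exI[of _ "max M 0"]) auto
  qed
  then obtain M where M: "\<And>k. M k \<ge> 0" "\<And>k y. y \<in> \<phi> ` K \<Longrightarrow> \<bar>A n k y\<bar> \<le> M k" by metis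
  show "continuous_at_zero (test_functions K) {\<lambda>f. SUP x. cmod (nth_deriv n f x) |n. True} (\<lambda>f. q (S f))"
  proof (rule continuous_at_zeroI_sum)
    fix f assume fK: "f \<in> test_functions K"
    then have f: "f \<in> test_functions X" using K(2) test_functions_mono by blast
    have SfK: "S f \<in> test_functions (\<phi> ` K)" by (rule S_test_functions_compact[OF K fK])
    have le: "cmod (nth_deriv n (S f) y) \<le> (\<Sum>k\<le>n. M k * (SUP x. cmod (nth_deriv k f x)))" for y
    proof (cases "y \<in> \<phi> ` K")
      case True
      then have "y \<in> X" using K(2) by auto
      then have "cmod (nth_deriv n (S f) y) \<le> (\<Sum>k\<le>n. \<bar>A n k y\<bar> * cmod (nth_deriv k f (\<psi> y)))"
        by (simp add: A(2)[OF f] sum_norm_le)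
      also have "\<dots> \<le> (\<Sum>k\<le>n. M k * (SUP x. cmod (nth_deriv k f x)))"
        using M True nth_deriv_le_SUP[OF f] by (intro sum_mono mult_mono) auto
      finally show ?thesis .
    next
      case False
      have "nth_deriv n (S f) y = 0"
        using SfK compact_image_phi[OF K] False compact_imp_closed[OF compact_image_phi[OF K]]
        by (intro nth_deriv_eq_0_outside[of _ "\<phi> ` K"]) (auto simp: test_functions_compact_iff)
      moreover have "0 \<le> (SUP x. cmod (nth_deriv k f x))" for k
        using order_trans[OF norm_ge_zero nth_deriv_le_SUP[OF f]] .
      ultimately show ?thesis using M(1) by (simp add: sum_nonneg)
    qed
    show "q (S f) \<le> (\<Sum>k\<le>n. M k * (SUP x. cmod (nth_deriv k f x)))"
      unfolding q by (rule cSUP_least) (use le in auto)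
  qed (use M in auto)
qed

lemma continuous_linear_op_S: "continuous_linear_op (D_topology X) S"
proof (rule continuous_linear_op_D_topology[OF _ linear_on_S])
  fix K assume K: "compact K" "K \<subseteq> X"
  then have "compact (\<phi> ` K)" "\<phi> ` K \<subseteq> X" using compact_image_phi by auto
  then show "\<exists>L. compact L \<and> L \<subseteq> X \<and> continuous_map (DK_topology K) (DK_topology L) S"
    using continuous_map_DK_S[OF K] by blast
qed (use S_test_functions in blast)

lemma comp_op_eq_transpose_op: "comp_op X \<phi> = transpose_op (D_topology X) S"
  by (simp add: comp_op_def transpose_op_def fun_eq_iff)

end

subsection \<open>Involutions are power bounded and uniformly mean ergodic\<close>

lemma funpow_involution:
  assumes "\<And>x. x \<in> V \<Longrightarrow> T (T x) = x" "x \<in> V"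
  shows "(T ^^ m) x = (if even m then x else T x)"
  by (induction m) (use assms in auto)

text \<open>All powers are the identity or \<open>T\<close>, so the intersection of \<open>N\<close>
  with its preimage under \<open>T\<close> serves every power at once.\<close>

lemma power_bounded_involution:
  assumes V: "fun_subspace (topspace E)" and T: "continuous_linear_op E T"
    and inv: "\<And>x. x \<in> topspace E \<Longrightarrow> T (T x) = x"
  shows "power_bounded E T"
  unfolding power_bounded_def equicontinuous_ops_def
proof (intro allI impI)
  fix N assume N: "zero_nhd E N"
  have T': "continuous_map E E T" and lin: "linear_on (topspace E) T"
    using T by (simp_all add: continuous_linear_op_iff)
  have sub: "N \<subseteq> topspace E" using N openin_subset unfolding zero_nhd_def by blast
  let ?U = "N \<inter> {x \<in> topspace E. T x \<in> N}"
  have "zero_nhd E ?U"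
    using N openin_continuous_map_preimage[OF T', of N] fun_subspace_zero[OF V]
      linear_on_scale[OF lin fun_subspace_zero[OF V], of 0]
    by (auto simp: zero_nhd_def)
  moreover have "(T ^^ m) x \<in> N" if "x \<in> ?U" for m x
    using funpow_involution[of "topspace E" T x m] inv that by auto
  ultimately show "\<exists>U. zero_nhd E U \<and> (\<forall>S\<in>range ((^^) T). S ` U \<subseteq> N)"
    by (intro exI[of _ ?U]) auto
qed

text \<open>Two consecutive terms add up to x + T x. The sum starts with T x, so an odd
  \<open>n\<close> leaves one T x over, which is (x + T x) / 2 + (T x - x) / 2.\<close>

lemma cesaro_sum_involution:
  assumes inv: "\<And>x. x \<in> V \<Longrightarrow> T (T x) = x" and x: "x \<in> V"
  shows "(\<Sum>m=1..n. (T ^^ m) x i) =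
    of_nat n / 2 * (x i + T x i) + (if odd n then (T x i - x i) / 2 else (0::complex))"
proof (induction n)
  case (Suc n)
  have "(\<Sum>m=1..Suc n. (T ^^ m) x i) = (\<Sum>m=1..n. (T ^^ m) x i) + (T ^^ Suc n) x i" by simp
  also have "(T ^^ Suc n) x = (if even (Suc n) then x else T x)"
    by (rule funpow_involution[where V = V]) (fact inv x)+
  finally show ?case unfolding Suc.IH by (simp add: field_simps)
qed simp

text \<open>The error of the n-th mean is \<open>c n\<close> times \<open>W x\<close>.
  \<open>W\<close> maps bounded sets to bounded sets, which every neighbourhood of zero absorbs, and
  \<open>c n\<close> tends to 0.\<close>

lemma uniformly_mean_ergodic_involution:
  assumes V: "fun_subspace V" and P: "\<And>p. p \<in> P \<Longrightarrow> seminorm_on V p"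
    and T: "continuous_linear_op (lc_topology V P) T"
    and inv: "\<And>x. x \<in> V \<Longrightarrow> T (T x) = x"
  shows "uniformly_mean_ergodic (lc_topology V P) T"
proof -
  let ?E = "lc_topology V P"
  define Q where "Q = (\<lambda>x i. 1 / 2 * x i + 1 / 2 * T x i)"
  define W where "W = (\<lambda>x i. - 1 * x i + 1 * T x i)"
  define c :: "nat \<Rightarrow> complex" where "c n = (if odd n then 1 / of_nat (2 * n) else 0)" for n
  have Q: "continuous_linear_op ?E Q" and W: "continuous_linear_op ?E W"
    unfolding Q_def W_def by (rule continuous_linear_op_combination[OF V P T], assumption)+
  have QV: "Q x \<in> V" and WV: "W x \<in> V" if "x \<in> V" for x
    using Q W that unfolding continuous_linear_op_iff continuous_map by auto
  \<comment> \<open>For \<open>n = 0\<close> the mean is 0 because division by zero yields 0, hence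
    the restriction to positive \<open>n\<close>.\<close>
  have ces: "cesaro_mean T n x = (\<lambda>i. 1 * Q x i + c n * W x i)" if x: "x \<in> V" and n: "n > 0" for x n
  proof
    fix i
    have "cesaro_mean T n x i = 1 / of_nat n *
        (of_nat n / 2 * (x i + T x i) + (if odd n then (T x i - x i) / 2 else 0))"
      unfolding cesaro_mean_def
      by (subst cesaro_sum_involution[where V = V and T = T, OF inv x]) simp_all
    also have "\<dots> = 1 * Q x i + c n * W x i"
      using n by (auto simp: Q_def W_def c_def field_simps)
    finally show "cesaro_mean T n x i = 1 * Q x i + c n * W x i" .
  qed
  have unif: "\<forall>\<^sub>F n in sequentially. \<forall>x\<in>B. (\<lambda>i. cesaro_mean T n x i - Q x i) \<in> N"
    if B: "tvs_bounded ?E B" and N: "zero_nhd ?E N" for B N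
  proof -
    have WB: "tvs_bounded ?E (W ` B)" using tvs_bounded_image[OF _ W B] V by simp
    obtain r where r: "r > 0" "\<And>c. cmod c \<ge> r \<Longrightarrow> W ` B \<subseteq> (\<lambda>f i. c * f i) ` N"
      using WB[unfolded tvs_bounded_def, THEN conjunct2, rule_format, OF N] by blast
    have BV: "B \<subseteq> V" using B by (simp add: tvs_bounded_def)
    have "\<forall>\<^sub>F n in sequentially. real n \<ge> r"
      using filterlim_real_sequentially unfolding filterlim_at_top by blast
    then show ?thesis using eventually_gt_at_top[of 0]
    proof eventually_elim
      case (elim n)
      have "(\<lambda>i. c n * W x i) \<in> N" if x: "x \<in> B" for x
      proof (cases "odd n")
        case True
        \<comment> \<open>Once 2 n \<ge> r, the vector \<open>W x\<close> is 2 n times an element of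
          \<open>N\<close>, and for odd \<open>n\<close> the number \<open>c n\<close> is the
          inverse of 2 n.\<close>
        have "cmod (of_nat (2 * n)) = 2 * real n" by (simp add: norm_mult)
        then have "cmod (of_nat (2 * n)) \<ge> r" using elim by linarith
        then obtain f where "f \<in> N" "W x = (\<lambda>i. of_nat (2 * n) * f i)" using r(2) x by blast
        then show ?thesis using True elim by (simp add: c_def)
      qed (use N in \<open>simp add: c_def zero_nhd_def\<close>)
      then show ?case using ces elim BV by (auto simp: subset_iff)
    qed
  qed
  \<comment> \<open>Pointwise convergence is the uniform statement for the bounded set {x}.\<close>
  have lim: "limitin ?E (\<lambda>n. cesaro_mean T n x) (Q x) sequentially" if x: "x \<in> V" for x
    unfolding limitin_def topspace_lc_topology
  proof (intro conjI allI impI)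
    show "Q x \<in> V" by (rule QV[OF x])
    fix U assume "openin ?E U \<and> Q x \<in> U"
    then have U: "openin ?E U" "Q x \<in> U" by auto
    obtain F e where F: "finite F" "F \<subseteq> P" "e > 0" "{g \<in> V. \<forall>p\<in>F. p (\<lambda>i. g i - Q x i) < e} \<subseteq> U"
      using bspec[OF conjunct2[OF U(1)[unfolded openin_lc_topology]] U(2)] by blast
    have "\<forall>\<^sub>F n in sequentially. \<forall>p\<in>F. p (\<lambda>i. cesaro_mean T n x i - Q x i) < e"
    proof (intro eventually_ball_finite F(1) ballI)
      fix p assume "p \<in> F"
      then have p: "seminorm_on V p" "p \<in> P" using F(2) P by auto
      show "\<forall>\<^sub>F n in sequentially. p (\<lambda>i. cesaro_mean T n x i - Q x i) < e"
        using unif[OF tvs_bounded_singleton[OF V P x] zero_nhd_lc_topology_ball[OF V p F(3)]] by (auto elim: eventually_mono)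
    qed
    then show "\<forall>\<^sub>F n in sequentially. cesaro_mean T n x \<in> U"
      using eventually_gt_at_top[of 0]
    proof eventually_elim
      case (elim n)
      have "cesaro_mean T n x \<in> V"
        unfolding ces[OF x elim(2)] by (rule fun_subspace_lin[OF V QV[OF x] WV[OF x]])
      then show ?case using F(4) elim(1) by blast
    qed
  qed
  show ?thesis unfolding uniformly_mean_ergodic_def using Q lim unif by auto
qed

section \<open>The strong topology on the space of distributions\<close>

lemma D'_topology_eq:
  "D'_topology X = lc_topology (distributions X)
     {\<lambda>u. SUP f\<in>B. cmod (u f) |B. tvs_bounded (D_topology X) B \<and> B \<noteq> {}}"
  by (simp add: D'_topology_def strong_dual_def distributions_def)

lemma topspace_D'_topology [simp]: "topspace (D'_topology X) = distributions X"
  by (simp add: D'_topology_eq)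

lemma fun_subspace_distributions: "fun_subspace (distributions X)"
  unfolding distributions_def by (rule fun_subspace_dual_space)

lemma seminorm_on_distributions:
  "q \<in> {\<lambda>u. SUP f\<in>B. cmod (u f) |B. tvs_bounded (D_topology X) B \<and> B \<noteq> {}} \<Longrightarrow>
     seminorm_on (distributions X) q"
  unfolding distributions_def
  by (rule seminorm_on_strong_dual_family[OF fun_subspace_D_topology])

lemma tvs_bounded_D'_singleton: "u \<in> distributions X \<Longrightarrow> tvs_bounded (D'_topology X) {u}"
  unfolding D'_topology_eq
  using tvs_bounded_singleton[OF fun_subspace_distributions seminorm_on_distributions] .

lemma continuous_map_D'_evaluation:
  "f \<in> test_functions X \<Longrightarrow> continuous_map (D'_topology X) euclidean (\<lambda>u. u f)"
  unfolding D'_topology_def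
  by (rule continuous_map_evaluation[OF fun_subspace_D_topology tvs_bounded_D_singleton])

section \<open>The composition operator on distributions: involutions and unbounded orbits\<close>

context interval_diffeo
begin

abbreviation T :: "((real \<Rightarrow> complex) \<Rightarrow> complex) \<Rightarrow> ((real \<Rightarrow> complex) \<Rightarrow> complex)"
  where "T \<equiv> comp_op X \<phi>"

lemma continuous_linear_op_T: "continuous_linear_op (D'_topology X) T"
  unfolding D'_topology_def comp_op_eq_transpose_op
  by (rule continuous_linear_op_transpose_op[OF fun_subspace_D_topology continuous_linear_op_S])

lemma funpow_S_test_functions: "f \<in> test_functions X \<Longrightarrow> (S ^^ m) f \<in> test_functions X"
  by (induction m) (use S_test_functions in auto)

text \<open>Moves the iteration from distributions to test functions. The induction keeps
  \<open>u\<close> arbitrary since the innermost application of \<open>T\<close> is peeled off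
  first.\<close>

lemma funpow_T: "f \<in> test_functions X \<Longrightarrow> (T ^^ m) u f = u ((S ^^ m) f)"
proof (induction m arbitrary: u)
  case (Suc m)
  have "(T ^^ Suc m) u f = (T ^^ m) (T u) f" by (simp only: funpow_Suc_right o_apply)
  also have "\<dots> = T u ((S ^^ m) f)" using Suc by blast
  also have "\<dots> = u ((S ^^ Suc m) f)"
    using funpow_S_test_functions[OF Suc.prems, of m] by (simp add: comp_op_def)
  finally show ?case .
qed simp

text \<open>It suffices that S (S f) = f. As \<psi> is an involution too, the two Jacobian factors
  multiply to the modulus of the derivative of the identity.\<close>

lemma T_involution:
  assumes inv: "\<And>x. x \<in> X \<Longrightarrow> \<phi> (\<phi> x) = x" and u: "u \<in> distributions X"
  shows "T (T u) = u"
proof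
  fix f
  show "T (T u) f = u f"
  proof (cases "f \<in> test_functions X")
    case f: True
    have SS: "S (S f) = f"
    proof
      fix y
      show "S (S f) y = f y"
      proof (cases "y \<in> X")
        case y: True
        \<comment> \<open>The hypothesis at \<psi> (\<psi> z), whose image under \<phi> \<circ>
          \<phi> is z.\<close>
        have eq: "\<psi> (\<psi> z) = z" if "z \<in> X" for z
          using inv[of "\<psi> (\<psi> z)"] that by simp
        have "((\<lambda>z. \<psi> (\<psi> z)) has_field_derivative deriv \<psi> (\<psi> y) * deriv \<psi> y) (at y)"
          by (rule DERIV_chain2[OF DERIV_psi DERIV_psi]) (use y in auto)
        moreover have "((\<lambda>z. \<psi> (\<psi> z)) has_field_derivative 1) (at y)"
          by (rule has_field_derivative_transform_within_open[OF DERIV_ident open_X y])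
            (simp add: eq)
        ultimately have "deriv \<psi> (\<psi> y) * deriv \<psi> y = 1" by (rule DERIV_unique)
        then have "\<bar>deriv \<psi> y\<bar> * \<bar>deriv \<psi> (\<psi> y)\<bar> = 1" by (metis abs_1 abs_mult mult.commute)
        then show ?thesis using y by (simp add: comp_transpose_eq eq)
      next
        case False
        then show ?thesis using f by (auto simp: comp_transpose_eq elim!: test_functionsE)
      qed
    qed
    then show ?thesis using f S_test_functions by (simp add: comp_op_def)
  next
    case False
    then show ?thesis using u by (simp add: comp_op_def distributions_def dual_space_def)
  qed
qed

lemma ergodic_of_T_involution:
  assumes "\<And>u. u \<in> distributions X \<Longrightarrow> T (T u) = u"
  shows "power_bounded (D'_topology X) T" "uniformly_mean_ergodic (D'_topology X) T"
proof -
  show "power_bounded (D'_topology X) T"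
    using power_bounded_involution[OF _ continuous_linear_op_T] fun_subspace_distributions assms
    by simp
  show "uniformly_mean_ergodic (D'_topology X) T"
    unfolding D'_topology_eq
    by (rule uniformly_mean_ergodic_involution[OF fun_subspace_distributions
          seminorm_on_distributions continuous_linear_op_T[unfolded D'_topology_eq] assms])
qed

text \<open>Evaluation at \<open>f\<close> is continuous. Power boundedness would bound all numbers
  u (S^m f), and mean ergodicity would make their Cesaro means converge. Non-negativity keeps the
  odd terms from cancelling the growth of the even ones.\<close>

lemma not_ergodic:
  assumes u: "u \<in> distributions X" and f: "f \<in> test_functions X"
    and nn: "\<And>m. Re (u ((S ^^ m) f)) \<ge> 0"
    and unb: "filterlim (\<lambda>k. Re (u ((S ^^ (2 * k)) f))) at_top sequentially"
  shows "\<not> power_bounded (D'_topology X) T" "\<not> mean_ergodic (D'_topology X) T"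
proof -
  let ?E = "D'_topology X"
  define a where "a m = Re (u ((S ^^ m) f))" for m
  have a_nn: "a m \<ge> 0" for m using nn by (simp add: a_def)
  have ev: "\<forall>\<^sub>F k in sequentially. a (2 * k) \<ge> M" for M
    using unb unfolding filterlim_at_top a_def by blast
  show "\<not> power_bounded ?E T"
  proof
    assume pb: "power_bounded ?E T"
    let ?N = "{v \<in> distributions X. v f \<in> ball 0 1}"
    have "zero_nhd ?E ?N"
      using openin_continuous_map_preimage[OF continuous_map_D'_evaluation[OF f], of "ball 0 1"]
        fun_subspace_zero[OF fun_subspace_distributions]
      by (simp add: zero_nhd_def)
    then have "\<exists>U. zero_nhd ?E U \<and> (\<forall>S\<in>range ((^^) T). S ` U \<subseteq> ?N)"
      using pb unfolding power_bounded_def equicontinuous_ops_def by (elim allE impE)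
    then obtain U where U: "zero_nhd ?E U" "\<And>m. (T ^^ m) ` U \<subseteq> ?N" by blast
    obtain r where r: "r > 0" "\<And>c. cmod c \<ge> r \<Longrightarrow> {u} \<subseteq> (\<lambda>f i. c * f i) ` U"
      using tvs_bounded_D'_singleton[OF u, unfolded tvs_bounded_def, THEN conjunct2, rule_format, OF U(1)]
      by blast
    \<comment> \<open>\<open>U\<close> absorbs \<open>u\<close>, so \<open>u\<close> is
      \<open>r\<close> times some \<open>v\<close> in \<open>U\<close>, and every power of
      \<open>T\<close> keeps the value of \<open>v\<close> at \<open>f\<close> inside the unit
      disc.\<close>
    obtain v where v: "v \<in> U" "u = (\<lambda>i. of_real r * v i)" using r(2)[of "of_real r"] r(1) by auto
    have "cmod (v ((S ^^ m) f)) < 1" for m using U(2)[of m] v(1) funpow_T[OF f, of m v] by auto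
    then have "cmod (u ((S ^^ m) f)) < r" for m using r(1) v(2) by (simp add: norm_mult)
    then have "a m < r" for m unfolding a_def using complex_Re_le_cmod order_le_less_trans by blast
    moreover obtain k where "a (2 * k) \<ge> r"
      using eventually_happens[OF ev[of r]] by auto
    ultimately show False by (meson not_less)
  qed
  show "\<not> mean_ergodic ?E T"
  proof
    assume "mean_ergodic ?E T"
    then obtain P where "limitin ?E (\<lambda>n. cesaro_mean T n u) (P u) sequentially"
      using u unfolding mean_ergodic_def by auto
    then have "(\<lambda>n. cesaro_mean T n u f) \<longlonglongrightarrow> P u f"
      using continuous_map_limit[OF continuous_map_D'_evaluation[OF f]] by (fastforce simp: o_def)
    then have "Bseq (\<lambda>n. cesaro_mean T n u f)" by (meson convergentI convergent_imp_Bseq)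
    then obtain C where C: "C > 0" "\<And>n. cmod (cesaro_mean T n u f) \<le> C" unfolding Bseq_def by blast
    have ces: "(\<Sum>m=1..n. a m) \<le> C * real n" if "n > 0" for n
    proof -
      have "Re (cesaro_mean T n u f) = (\<Sum>m=1..n. a m) / real n"
        unfolding cesaro_mean_def funpow_T[OF f] a_def by (simp add: Re_divide_of_nat)
      then have "(\<Sum>m=1..n. a m) / real n \<le> C"
        using C(2)[of n] complex_Re_le_cmod[of "cesaro_mean T n u f"] by linarith
      then show ?thesis using that by (simp add: field_simps)
    qed
    obtain K where K: "\<And>k. k \<ge> K \<Longrightarrow> a (2 * k) \<ge> 4 * C + 1"
      using ev[of "4 * C + 1"] unfolding eventually_sequentially by blast
    \<comment> \<open>There are K + 1 indices k from K + 1 to N, each contributing at least 4 C + 1,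
      while the means allow at most 2 N C = (4 K + 2) C, which is at most 4 C (K + 1).\<close>
    define N where "N = 2 * K + 1"
    have "real (K + 1) * (4 * C + 1) \<le> (\<Sum>k=K+1..N. a (2 * k))"
      using sum_bounded_below[of "{K+1..N}" "4 * C + 1" "\<lambda>k. a (2 * k)"] K
      by (simp add: N_def)
    also have "\<dots> = (\<Sum>m\<in>(\<lambda>k. 2 * k) ` {K+1..N}. a m)" by (simp add: sum.reindex inj_on_def)
    also have "\<dots> \<le> (\<Sum>m=1..2*N. a m)" by (rule sum_mono2) (auto simp: a_nn)
    also have "\<dots> \<le> C * real (2 * N)" by (rule ces) (simp add: N_def)
    also have "\<dots> \<le> real (K + 1) * (4 * C)" using C(1) by (simp add: N_def algebra_simps)
    finally show False by (simp add: algebra_simps)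
  qed
qed

end

subsection \<open>Bump functions and regular distributions\<close>

text \<open>The function exp (-1/x), flat at 0, times a power of 1/x. Differentiating exp (-1/x)
  produces such powers, so linear combinations of these functions are closed under
  differentiation.\<close>

definition flat_exp :: "nat \<Rightarrow> real \<Rightarrow> real" where
  "flat_exp n x = (if x > 0 then inverse x ^ n / exp (inverse x) else 0)"

lemma flat_exp_nonneg: "flat_exp n x \<ge> 0"
  by (simp add: flat_exp_def)

lemma tendsto_flat_exp_0: "(flat_exp n \<longlongrightarrow> 0) (at 0)"
proof (rule filterlim_split_at)
  have "((\<lambda>x. inverse x ^ n / exp (inverse x)) \<longlongrightarrow> 0) (at_right (0::real))"
    by (rule filterlim_compose[OF tendsto_power_div_exp_0 filterlim_inverse_at_top_right])
  moreover have "eventually (\<lambda>x. inverse x ^ n / exp (inverse x) = flat_exp n x) (at_right 0)"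
    unfolding eventually_at_filter by (simp add: flat_exp_def)
  ultimately show "(flat_exp n \<longlongrightarrow> 0) (at_right 0)" by (metis (mono_tags) Lim_transform_eventually)
  have "eventually (\<lambda>x. 0 = flat_exp n x) (at_left 0)"
    unfolding eventually_at_filter by (simp add: flat_exp_def)
  then show "(flat_exp n \<longlongrightarrow> 0) (at_left 0)"
    using Lim_transform_eventually[OF tendsto_const] by blast
qed

lemma DERIV_flat_exp:
  "(flat_exp n has_field_derivative flat_exp (n + 2) x - real n * flat_exp (n + 1) x) (at x)"
proof -
  consider "x > 0" | "x < 0" | "x = 0" by linarith
  then show ?thesis
  proof cases
    case 1
    let ?t = "inverse x"
    have "((\<lambda>t. t ^ n / exp t) has_field_derivative
        (real n * ?t ^ (n - 1) - ?t ^ n) / exp ?t) (at ?t)"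
      by (auto intro!: derivative_eq_intros simp: diff_divide_distrib field_simps)
    from DERIV_chain2[OF this DERIV_inverse[of x]]
    have "((\<lambda>x. inverse x ^ n / exp (inverse x)) has_field_derivative
        (real n * ?t ^ (n - 1) - ?t ^ n) / exp ?t * - (?t ^ Suc (Suc 0))) (at x)"
      using 1 by simp
    also have "(real n * ?t ^ (n - 1) - ?t ^ n) / exp ?t * - (?t ^ Suc (Suc 0)) =
        flat_exp (n + 2) x - real n * flat_exp (n + 1) x"
      \<comment> \<open>\<open>n = 0\<close> is separate because \<open>n - 1\<close> is truncated
        subtraction.\<close>
      using 1 by (cases n) (simp_all add: flat_exp_def divide_inverse algebra_simps)
    finally have "((\<lambda>x. inverse x ^ n / exp (inverse x)) has_field_derivative
        flat_exp (n + 2) x - real n * flat_exp (n + 1) x) (at x)" .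
    then show ?thesis
      by (rule has_field_derivative_transform_within_open[where S = "{0<..}"])
        (use 1 in \<open>auto simp: flat_exp_def\<close>)
  next
    case 2
    have "(flat_exp n has_field_derivative 0) (at x)"
      by (rule has_field_derivative_transform_within_open[OF DERIV_const, where S = "{..<0}"])
        (use 2 in \<open>auto simp: flat_exp_def\<close>)
    then show ?thesis using 2 by (simp add: flat_exp_def)
  next
    case 3
    \<comment> \<open>Dividing by h raises the power of 1/h by one, so the difference quotient at 0
      is the next flat function; at h = 0 both sides are 0.\<close>
    have "(\<lambda>h. (flat_exp n (0 + h) - flat_exp n 0) / h) = flat_exp (n + 1)"
      by (auto simp: fun_eq_iff flat_exp_def field_simps)
    then have "(flat_exp n has_field_derivative 0) (at 0)"
      using tendsto_flat_exp_0[of "n + 1"] by (simp add: DERIV_def)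
    then show ?thesis using 3 by (simp add: flat_exp_def)
  qed
qed

text \<open>A class closed under differentiation that contains the bump, as
  \<open>smooth_coinduct\<close> requires. The constant \<open>c\<close> absorbs the coefficients
  and signs that derivatives create.\<close>

inductive_set bump_combinations :: "real \<Rightarrow> real \<Rightarrow> (real \<Rightarrow> complex) set" for a b where
  product: "(\<lambda>x. of_real (c * flat_exp n (x - a) * flat_exp m (b - x))) \<in> bump_combinations a b"
| add: "f \<in> bump_combinations a b \<Longrightarrow> g \<in> bump_combinations a b \<Longrightarrow>
    (\<lambda>x. f x + g x) \<in> bump_combinations a b"

lemma bump_combinations_deriv:
  assumes "f \<in> bump_combinations a b"
  shows "\<exists>f'\<in>bump_combinations a b. \<forall>x. (f has_vector_derivative f' x) (at x)"
  using assms
proof induction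
  case (product c n m)
  let ?p = "\<lambda>c n m x. complex_of_real (c * flat_exp n (x - a) * flat_exp m (b - x))"
  let ?f' = "\<lambda>x. (?p c (n + 2) m x + ?p (- c * real n) (n + 1) m x) +
    (?p (- c) n (m + 2) x + ?p (c * real m) n (m + 1) x)"
  have "(?p c n m has_vector_derivative ?f' x) (at x)" for x
  proof -
    have der: "((\<lambda>x. c * flat_exp n (x - a) * flat_exp m (b - x)) has_field_derivative
        c * (flat_exp (n + 2) (x - a) - real n * flat_exp (n + 1) (x - a)) * flat_exp m (b - x) +
        c * flat_exp n (x - a) * - (flat_exp (m + 2) (b - x) - real m * flat_exp (m + 1) (b - x))) (at x)"
      by (rule derivative_eq_intros DERIV_chain2[OF DERIV_flat_exp] refl | simp)+
    show ?thesis
      by (rule has_vector_derivative_eq_rhs[OF has_vector_derivative_of_real[OF der]])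
        (simp add: algebra_simps)
  qed
  then show ?case by (intro bexI[of _ ?f'] bump_combinations.intros) auto
next
  case (add f g)
  then obtain f' g' where "f' \<in> bump_combinations a b" "g' \<in> bump_combinations a b"
      "\<forall>x. (f has_vector_derivative f' x) (at x)" "\<forall>x. (g has_vector_derivative g' x) (at x)"
    by blast
  then show ?case
    by (intro bexI[of _ "\<lambda>x. f' x + g' x"] bump_combinations.add)
      (auto intro!: has_vector_derivative_add)
qed

lemma bump_function:
  fixes a b :: real
  obtains f where "f \<in> test_functions {a..b}" "\<And>x. Re (f x) \<ge> 0" "\<And>x. a < x \<Longrightarrow> x < b \<Longrightarrow> Re (f x) > 0"
proof -
  define f where "f x = complex_of_real (1 * flat_exp 0 (x - a) * flat_exp 0 (b - x))" for x
  have "f \<in> bump_combinations a b" unfolding f_def by (rule bump_combinations.product)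
  then have "smooth f" by (rule smooth_coinduct) (rule bump_combinations_deriv)
  then have "f \<in> test_functions {a..b}"
    by (auto simp: test_functions_compact_iff f_def flat_exp_def)
  then show thesis
    by (rule that) (simp_all add: f_def flat_exp_nonneg, simp add: flat_exp_def)
qed

section \<open>Locally integrable functions as distributions\<close>

definition locally_integrable :: "(real \<Rightarrow> real) \<Rightarrow> bool" where
  "locally_integrable g \<longleftrightarrow> (\<forall>a b. g absolutely_integrable_on {a..b})"

text \<open>Test functions vanish off \<open>X\<close>, so the integral may run over the line; the
  zero branch is again the convention of \<open>dual_space\<close>.\<close>

definition regular_distribution :: "real set \<Rightarrow> (real \<Rightarrow> real) \<Rightarrow> (real \<Rightarrow> complex) \<Rightarrow> complex" where
  "regular_distribution X g f =
     (if f \<in> test_functions X then integral UNIV (\<lambda>x. g x *\<^sub>R f x) else 0)"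

lemma test_functions_interval:
  assumes "f \<in> test_functions X"
  obtains a b where "f \<in> test_functions {a..b}"
proof -
  obtain K where K: "compact K" "f \<in> test_functions K" using assms test_functions_iff by blast
  obtain a b where "K \<subseteq> {a..b}" using compact_imp_bounded[OF K(1)] bounded_subset_cbox_symmetric
    by (metis box_real(2))
  then show thesis using that K(2) test_functions_mono by blast
qed

lemma absolutely_integrable_weighted_test_function:
  assumes g: "locally_integrable g" and f: "f \<in> test_functions X"
  shows "(\<lambda>x. g x *\<^sub>R f x) absolutely_integrable_on UNIV"
proof -
  obtain a b where f: "f \<in> test_functions {a..b}" using f by (rule test_functions_interval)
  then have sm: "smooth f" and 0: "\<And>x. x \<notin> {a..b} \<Longrightarrow> f x = 0"
    by (auto simp: test_functions_compact_iff)
  have cont: "continuous_on {a..b} f"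
    using continuous_on_nth_deriv[OF sm, of _ 0] by simp
  \<comment> \<open>The bounded measurable factor \<open>f\<close> is the first argument, the
    integrable weight \<open>g\<close> the second.\<close>
  have bil: "bilinear (\<lambda>(y::complex) (x::real). x *\<^sub>R y)"
    unfolding bilinear_def by (auto intro!: linearI simp: algebra_simps)
  have "(\<lambda>x. g x *\<^sub>R f x) absolutely_integrable_on {a..b}"
  proof (rule absolutely_integrable_bounded_measurable_product[OF bil])
    show "f \<in> borel_measurable (lebesgue_on {a..b})"
      by (rule continuous_imp_measurable_on_sets_lebesgue[OF cont]) simp
    show "bounded (f ` {a..b})" by (intro compact_imp_bounded compact_continuous_image cont) simp
  qed (use g in \<open>auto simp: locally_integrable_def\<close>)
  moreover have "(\<lambda>x. if x \<in> {a..b} then g x *\<^sub>R f x else 0) = (\<lambda>x. g x *\<^sub>R f x)"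
    using 0 by auto
  ultimately show ?thesis
    using absolutely_integrable_restrict_UNIV[of "{a..b}" "\<lambda>x. g x *\<^sub>R f x"] by simp
qed

lemma regular_distribution_bound:
  assumes g: "locally_integrable g" and f: "f \<in> test_functions X" "f \<in> test_functions {a..b}"
  shows "cmod (regular_distribution X g f) \<le>
    integral {a..b} (\<lambda>x. \<bar>g x\<bar>) * (SUP x. cmod (nth_deriv 0 f x))"
proof -
  let ?q = "SUP x. cmod (nth_deriv 0 f x)"
  have i: "(\<lambda>x. g x *\<^sub>R f x) integrable_on UNIV"
    using absolutely_integrable_weighted_test_function[OF g f(1)] set_lebesgue_integral_eq_integral(1) by blast
  have ig: "(\<lambda>x. \<bar>g x\<bar> * ?q) integrable_on {a..b}"
    using g by (intro integrable_on_mult_left) (auto simp: locally_integrable_def absolutely_integrable_on_def)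
  have 0: "\<And>x. x \<notin> {a..b} \<Longrightarrow> f x = 0" using f(2) by (auto simp: test_functions_compact_iff)
  have "cmod (integral UNIV (\<lambda>x. g x *\<^sub>R f x)) \<le>
      integral UNIV (\<lambda>x. if x \<in> {a..b} then \<bar>g x\<bar> * ?q else 0)"
  proof (rule integral_norm_bound_integral[OF i])
    show "(\<lambda>x. if x \<in> {a..b} then \<bar>g x\<bar> * ?q else 0) integrable_on UNIV"
      using ig by (simp only: integrable_restrict_UNIV)
    show "cmod (g x *\<^sub>R f x) \<le> (if x \<in> {a..b} then \<bar>g x\<bar> * ?q else 0)" for x
      using nth_deriv_le_SUP[OF f(1), of 0 x] 0[of x] by (auto intro!: mult_left_mono)
  qed
  also have "\<dots> = integral {a..b} (\<lambda>x. \<bar>g x\<bar>) * ?q"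
    unfolding Henstock_Kurzweil_Integration.integral_restrict_UNIV by simp
  finally show ?thesis using f(1) by (simp add: regular_distribution_def)
qed

lemma regular_distribution_lin:
  assumes g: "locally_integrable g" and f: "f \<in> test_functions X" and h: "h \<in> test_functions X"
  shows "regular_distribution X g (\<lambda>x. a * f x + b * h x) =
    a * regular_distribution X g f + b * regular_distribution X g h"
proof -
  have i: "(\<lambda>x. g x *\<^sub>R f x) integrable_on UNIV" if "f \<in> test_functions X" for f
    using absolutely_integrable_weighted_test_function[OF g that] set_lebesgue_integral_eq_integral(1) by blast
  note im = integrable_on_mult_right[OF i[OF f], of a] integrable_on_mult_right[OF i[OF h], of b]
  have "integral UNIV (\<lambda>x. g x *\<^sub>R (a * f x + b * h x)) =
      integral UNIV (\<lambda>x. a * (g x *\<^sub>R f x) + b * (g x *\<^sub>R h x))"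
    by (simp add: algebra_simps)
  also have "\<dots> = a * integral UNIV (\<lambda>x. g x *\<^sub>R f x) + b * integral UNIV (\<lambda>x. g x *\<^sub>R h x)"
    by (simp only: Henstock_Kurzweil_Integration.integral_add[OF im]
        Henstock_Kurzweil_Integration.integral_mult_right)
  finally show ?thesis
    using f h fun_subspace_lin[OF fun_subspace_test_functions f h, of a b]
    by (simp add: regular_distribution_def)
qed

text \<open>For supports in a fixed interval the pairing is bounded by the integral of \<bar>g\<bar>
  times the supremum of \<bar>f\<bar>. Hence its modulus is one of the seminorms that define
  \<open>D_topology X\<close>.\<close>

lemma regular_distribution_in_distributions:
  assumes g: "locally_integrable g"
  shows "regular_distribution X g \<in> distributions X"
proof -
  let ?u = "regular_distribution X g"
  note lin = regular_distribution_lin[OF g, of _ X]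
  have "(\<lambda>f. cmod (?u f)) \<in> D_seminorms X"
    unfolding D_seminorms_def
  proof (intro CollectI conjI allI impI)
    show "seminorm_on (test_functions X) (\<lambda>f. cmod (?u f))"
      by (rule seminorm_on_functional) (rule lin)
    fix K assume K: "compact K \<and> K \<subseteq> X"
    have sub: "test_functions K \<subseteq> test_functions X" using K test_functions_mono by blast
    obtain a b where ab: "K \<subseteq> {a..b}"
      using K compact_imp_bounded bounded_subset_cbox_symmetric by (metis box_real(2))
    show "continuous_map (DK_topology K) euclideanreal (\<lambda>f. cmod (?u f))"
      unfolding DK_topology_def
    proof (rule continuous_map_seminorm[OF fun_subspace_test_functions])
      show "seminorm_on (test_functions K) (\<lambda>f. cmod (?u f))"
        by (rule seminorm_on_functional) (use lin sub in blast)
      show "continuous_at_zero (test_functions K) {\<lambda>f. SUP x. cmod (nth_deriv n f x) |n. True}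
          (\<lambda>f. cmod (?u f))"
      proof (rule continuous_at_zeroI_sum)
        fix f assume f: "f \<in> test_functions K"
        show "cmod (?u f) \<le> (\<Sum>_\<in>{()}. integral {a..b} (\<lambda>x. \<bar>g x\<bar>) * (SUP x. cmod (nth_deriv 0 f x)))"
          using regular_distribution_bound[OF g, of f X a b] f sub test_functions_mono[OF ab] by auto
      next
        have "(\<lambda>x. \<bar>g x\<bar>) integrable_on {a..b}"
          using g by (simp add: locally_integrable_def absolutely_integrable_on_def)
        then show "integral {a..b} (\<lambda>x. \<bar>g x\<bar>) \<ge> 0"
          by (rule Henstock_Kurzweil_Integration.integral_nonneg) simp
      qed blast+
    qed
  qed
  then have "continuous_map (D_topology X) euclidean ?u"
    unfolding D_topology_eq
    by (intro continuous_map_functional[OF fun_subspace_test_functions lin] continuous_at_zeroI_member)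
  then show ?thesis
    using lin by (auto simp: distributions_def dual_space_def regular_distribution_def)
qed

text \<open>\<open>sqrt\<close> is an odd function here, so 2 * sqrt (x - p) is a primitive on both
  sides of \<open>p\<close> and continuous at \<open>p\<close>, the one exceptional point.\<close>

lemma locally_integrable_inverse_sqrt: "locally_integrable (\<lambda>x. inverse (sqrt \<bar>x - p\<bar>))"
  unfolding locally_integrable_def
proof (intro allI)
  fix a b :: real
  show "(\<lambda>x. inverse (sqrt \<bar>x - p\<bar>)) absolutely_integrable_on {a..b}"
  proof (cases "a \<le> b")
    case True
    have "((\<lambda>x. inverse (sqrt \<bar>x - p\<bar>)) has_integral 2 * sqrt (b - p) - 2 * sqrt (a - p)) {a..b}"
    proof (rule fundamental_theorem_of_calculus_interior_strong[of "{p}", OF _ True])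
      fix x assume "x \<in> {a<..<b} - {p}"
      then have x: "x - p \<noteq> 0" by auto
      have "(sqrt has_field_derivative inverse (sqrt \<bar>x - p\<bar>) / 2) (at (x - p))"
        by (rule DERIV_real_sqrt_generic[OF x]) (use real_sqrt_minus[of "x - p"] in auto)
      then have "((\<lambda>x. sqrt (x - p)) has_field_derivative inverse (sqrt \<bar>x - p\<bar>) / 2 * 1) (at x)"
        by (rule DERIV_chain2) (auto intro!: derivative_eq_intros)
      from DERIV_cmult[OF this, of 2]
      show "((\<lambda>x. 2 * sqrt (x - p)) has_vector_derivative inverse (sqrt \<bar>x - p\<bar>)) (at x)"
        by (simp add: has_real_derivative_iff_has_vector_derivative)
    qed (auto intro!: continuous_intros)
    then show ?thesis
      by (intro nonnegative_absolutely_integrable_1) (auto simp: has_integral_integrable)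
  qed simp
qed

subsection \<open>Orbits of the iterated diffeomorphism\<close>

lemma blow_up_weight_incseq:
  fixes s :: "nat \<Rightarrow> real"
  assumes "strict_mono s"
  obtains g where "locally_integrable g" "\<And>x. g x \<ge> 0"
    "\<And>M. \<forall>\<^sub>F m in sequentially. \<forall>y\<in>{s m..s (Suc m)}. g y \<ge> M"
proof (cases "bdd_above (range s)")
  case True
  define p where "p = (SUP i. s i)"
  have lim: "s \<longlonglongrightarrow> p"
    unfolding p_def using True assms by (intro LIMSEQ_incseq_SUP strict_mono_mono)
  \<comment> \<open>Strictness matters: as \<open>inverse 0 = 0\<close>, the weight is 0 at
    \<open>p\<close> itself.\<close>
  have less: "s m < p" for m
    using cSUP_upper[OF UNIV_I True, of "Suc m"] strict_monoD[OF assms, of m "Suc m"]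
    by (simp add: p_def)
  have "(\<lambda>m. sqrt (p - s m)) \<longlonglongrightarrow> sqrt (p - p)"
    by (intro tendsto_intros lim)
  then have "filterlim (\<lambda>m. inverse (sqrt (p - s m))) at_top sequentially"
    using less by (intro filterlim_inverse_at_top) auto
  then have ev: "\<forall>\<^sub>F m in sequentially. inverse (sqrt (p - s m)) \<ge> M" for M
    unfolding filterlim_at_top by blast
  have le: "inverse (sqrt (p - s m)) \<le> inverse (sqrt \<bar>y - p\<bar>)" if "y \<in> {s m..s (Suc m)}" for m y
    using that less[of m] less[of "Suc m"] by (intro le_imp_inverse_le) auto
  show thesis
  proof (rule that[of "\<lambda>x. inverse (sqrt \<bar>x - p\<bar>)"])
    show "\<forall>\<^sub>F m in sequentially. \<forall>y\<in>{s m..s (Suc m)}. inverse (sqrt \<bar>y - p\<bar>) \<ge> M" for M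
      using ev[of M] by eventually_elim (use le order_trans in blast)
  qed (auto intro: locally_integrable_inverse_sqrt)
next
  case False
  have ev: "\<forall>\<^sub>F m in sequentially. s m \<ge> M" for M
  proof -
    have "\<exists>N. \<not> s N \<le> M" using False by (auto simp: bdd_above_def)
    then obtain N where "s N \<ge> M" using linear by blast
    then show ?thesis
      unfolding eventually_sequentially using strict_mono_leD[OF assms] order_trans by blast
  qed
  show thesis
  proof (rule that[of abs])
    show "locally_integrable abs"
      unfolding locally_integrable_def
      by (intro allI absolutely_integrable_continuous_real continuous_intros)
    show "\<forall>\<^sub>F m in sequentially. \<forall>y\<in>{s m..s (Suc m)}. \<bar>y\<bar> \<ge> M" for M
      using ev[of M] by eventually_elim auto
  qed auto
qed

text \<open>A decreasing sequence is reflected to an increasing one, and the weight with it.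
  \<open>closed_segment\<close> ignores the order of its endpoints, so both directions share one
  statement.\<close>

lemma blow_up_weight:
  fixes s :: "nat \<Rightarrow> real"
  assumes "strict_mono s \<or> strict_mono (\<lambda>m. - s m)"
  obtains g where "locally_integrable g" "\<And>x. g x \<ge> 0"
    "\<And>M. \<forall>\<^sub>F m in sequentially. \<forall>y\<in>closed_segment (s m) (s (Suc m)). g y \<ge> M"
  using assms
proof
  assume s: "strict_mono s"
  then have seg: "closed_segment (s m) (s (Suc m)) = {s m..s (Suc m)}" for m
    by (simp add: closed_segment_eq_real_ivl strict_mono_less_eq)
  obtain g where g: "locally_integrable g" "\<And>x. g x \<ge> 0"
      "\<And>M. \<forall>\<^sub>F m in sequentially. \<forall>y\<in>{s m..s (Suc m)}. g y \<ge> M"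
    by (rule blow_up_weight_incseq[OF s]) blast
  show thesis by (rule that[of g]) (use g in \<open>simp_all add: seg\<close>)
next
  assume s: "strict_mono (\<lambda>m. - s m)"
  obtain g where g: "locally_integrable g" "\<And>x. g x \<ge> 0"
      "\<And>M. \<forall>\<^sub>F m in sequentially. \<forall>y\<in>{- s m..- s (Suc m)}. g y \<ge> M"
    by (rule blow_up_weight_incseq[OF s]) blast
  have seg: "closed_segment (s m) (s (Suc m)) = {s (Suc m)..s m}" for m
    using strict_monoD[OF s, of m "Suc m"] by (simp add: closed_segment_eq_real_ivl)
  show thesis
  proof (rule that[of "\<lambda>x. g (- x)"])
    show "locally_integrable (\<lambda>x. g (- x))"
      unfolding locally_integrable_def
    proof (intro allI)
      fix a b
      show "(\<lambda>x. g (- x)) absolutely_integrable_on {a..b}"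
        using absolutely_integrable_reflect_real[where f = g and a = "- b" and b = "- a"] g(1)
        by (simp add: locally_integrable_def)
    qed
    show "\<forall>\<^sub>F m in sequentially. \<forall>y\<in>closed_segment (s m) (s (Suc m)). g (- y) \<ge> M" for M
      using g(3)[of M] unfolding seg by eventually_elim auto
  qed (use g in simp)
qed

section \<open>Mass and support of the iterated transposes along a monotone orbit\<close>

context interval_diffeo
begin

lemma Re_integrable:
  assumes "f \<in> test_functions X"
  shows "(\<lambda>x. Re (f x)) absolutely_integrable_on X"
proof -
  \<comment> \<open>The constant weight 1 reduces the claim to the integrability of weighted test
    functions.\<close>
  have "locally_integrable (\<lambda>_. 1)"
    unfolding locally_integrable_def by (intro allI absolutely_integrable_continuous_real) simp
  from absolutely_integrable_weighted_test_function[OF this assms]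
  have "f absolutely_integrable_on UNIV" by simp
  from absolutely_integrable_linear[OF this bounded_linear_Re]
  have "(\<lambda>x. Re (f x)) absolutely_integrable_on UNIV" by (simp add: o_def)
  then show ?thesis by (rule set_integrable_subset) (use open_X in auto)
qed

text \<open>Change of variables along \<psi>: the factor \<bar>\<psi>'\<bar> in \<open>S\<close> is
  exactly the Jacobian.\<close>

lemma integral_Re_S:
  assumes f: "f \<in> test_functions X"
  shows "integral X (\<lambda>y. Re (S f y)) = integral X (\<lambda>x. Re (f x))"
proof -
  have im: "\<psi> ` X = X" using bij_betw_inv_into[OF bij] by (simp add: bij_betw_def)
  have "integral X (\<lambda>y. \<bar>deriv \<psi> y\<bar> * Re (f (\<psi> y))) = integral X (\<lambda>x. Re (f x))"
    using has_absolute_integral_change_of_variables_1'[of X \<psi> "deriv \<psi>" "\<lambda>x. Re (f x)"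
        "integral X (\<lambda>x. Re (f x))"] open_X DERIV_psi Re_integrable[OF f] bij_betw_inv_into[OF bij]
    by (auto simp: im bij_betw_def intro: has_field_derivative_at_within)
  moreover have "integral X (\<lambda>y. Re (S f y)) = integral X (\<lambda>y. \<bar>deriv \<psi> y\<bar> * Re (f (\<psi> y)))"
    by (rule integral_cong) (simp add: comp_transpose_eq)
  ultimately show ?thesis by simp
qed

lemma integral_Re_funpow_S:
  assumes f: "f \<in> test_functions X"
  shows "integral X (\<lambda>y. Re ((S ^^ m) f y)) = integral X (\<lambda>x. Re (f x))"
  by (induction m) (simp_all add: integral_Re_S funpow_S_test_functions[OF f])

lemma Re_funpow_S_nonneg:
  assumes "\<And>x. Re (f x) \<ge> 0" shows "Re ((S ^^ m) f y) \<ge> 0"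
  by (induction m arbitrary: y) (simp_all add: comp_transpose_eq assms)

lemma funpow_S_eq_0:
  assumes "\<And>x. x \<notin> K \<Longrightarrow> f x = 0" "y \<notin> (\<phi> ^^ m) ` K"
  shows "(S ^^ m) f y = 0"
  using assms(2)
proof (induction m arbitrary: y)
  case (Suc m)
  then show ?case using S_eq_0[of "(\<phi> ^^ m) ` K" "(S ^^ m) f" y] by (simp add: image_comp)
qed (use assms(1) in simp)

text \<open>The real part of \<open>(S ^^ m) f\<close> is non-negative, lives on the image of
  \<open>K\<close> under the m-th iterate of \<phi>, and has the same integral as that of
  \<open>f\<close>. A lower bound of \<open>g\<close> on that image thus multiplies the
  mass.\<close>

lemma Re_regular_distribution_funpow_S:
  fixes g :: "real \<Rightarrow> real" and f :: "real \<Rightarrow> complex" and K :: "real set" and M :: real and m :: nat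
  assumes g: "locally_integrable g" and f: "f \<in> test_functions X" "\<And>x. Re (f x) \<ge> 0"
    and K: "\<And>x. x \<notin> K \<Longrightarrow> f x = 0" and M: "\<And>y. y \<in> (\<phi> ^^ m) ` K \<Longrightarrow> g y \<ge> M"
  shows "Re (regular_distribution X g ((S ^^ m) f)) \<ge> M * integral X (\<lambda>x. Re (f x))"
proof -
  let ?h = "(S ^^ m) f"
  note h = funpow_S_test_functions[OF f(1), of m]
  have 0: "?h y = 0" if "y \<notin> X" for y using h that by (auto elim!: test_functionsE)
  have i: "(\<lambda>x. g x *\<^sub>R ?h x) integrable_on UNIV"
    using absolutely_integrable_weighted_test_function[OF g h] set_lebesgue_integral_eq_integral(1) by blast
  have "M * integral X (\<lambda>x. Re (f x)) = integral X (\<lambda>y. M * Re (?h y))"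
    by (simp add: integral_Re_funpow_S[OF f(1)])
  \<comment> \<open>Extension by zero lets both integrals run over the whole line, where the
    integrands compare pointwise.\<close>
  also have "\<dots> = integral UNIV (\<lambda>y. if y \<in> X then M * Re (?h y) else 0)"
    by (simp only: Henstock_Kurzweil_Integration.integral_restrict_UNIV)
  also have "\<dots> \<le> integral UNIV (\<lambda>y. Re (g y *\<^sub>R ?h y))"
  proof (rule integral_le)
    have "(\<lambda>y. M * Re (?h y)) integrable_on X"
      using Re_integrable[OF h] by (intro integrable_on_mult_right) (auto simp: absolutely_integrable_on_def)
    then show "(\<lambda>y. if y \<in> X then M * Re (?h y) else 0) integrable_on UNIV"
      by (simp only: integrable_restrict_UNIV)
    show "(\<lambda>y. Re (g y *\<^sub>R ?h y)) integrable_on UNIV"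
      using integrable_linear[OF i bounded_linear_Re] by (simp add: o_def)
    show "(if y \<in> X then M * Re (?h y) else 0) \<le> Re (g y *\<^sub>R ?h y)" for y
    proof (cases "y \<in> (\<phi> ^^ m) ` K")
      case True
      then show ?thesis
        using M[OF True] Re_funpow_S_nonneg[of f, OF f(2), where m = m and y = y] 0[of y] by (auto intro: mult_right_mono)
    next
      case False
      then show ?thesis using funpow_S_eq_0[OF K False] by simp
    qed
  qed
  also have "\<dots> = Re (integral UNIV (\<lambda>y. g y *\<^sub>R ?h y))"
    using integral_linear[OF i bounded_linear_Re] by (simp add: o_def)
  finally show ?thesis using h by (simp add: regular_distribution_def)
qed

text \<open>A continuous injective map on an interval is strictly monotone, and the square of an
  increasing or a decreasing self-map is increasing.\<close>

lemma strict_mono_on_phi_phi: "strict_mono_on X (\<lambda>x. \<phi> (\<phi> x))"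
proof -
  have "strict_mono_on X \<phi> \<or> strict_antimono_on X \<phi>"
    using injective_eq_monotone_map[OF interval_X real_analytic_on_continuous_on[OF analytic_phi]] bij
    by (simp add: bij_betw_def)
  then show ?thesis by (auto simp: monotone_on_def)
qed

lemma funpow_phi_in: "x \<in> X \<Longrightarrow> (\<phi> ^^ m) x \<in> X"
  by (induction m) auto

lemma not_ergodic_of_not_involution:
  assumes x: "x \<in> X" and ne: "\<phi> (\<phi> x) \<noteq> x"
  shows "\<not> power_bounded (D'_topology X) T \<and> \<not> mean_ergodic (D'_topology X) T"
proof -
  define s where "s m = (\<phi> ^^ (2 * m)) x" for m
  have s0: "s 0 = x" and s1: "s (Suc 0) = \<phi> (\<phi> x)"
    by (simp_all add: s_def numeral_2_eq_2)
  have sX: "s m \<in> X" for m unfolding s_def by (rule funpow_phi_in[OF x])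
  have sSuc: "s (Suc m) = \<phi> (\<phi> (s m))" for m by (simp add: s_def)
  note mono = strict_mono_onD[OF strict_mono_on_phi_phi]
  \<comment> \<open>The sign of the first step is passed along the orbit by monotonicity of \<phi>
    \<circ> \<phi>.\<close>
  have "strict_mono s \<or> strict_mono (\<lambda>m. - s m)"
  proof (cases "\<phi> (\<phi> x) > x")
    case True
    have "s m < s (Suc m)" for m
      by (induction m) (use True s0 s1 in simp, simp only: sSuc, rule mono, simp_all add: sX)
    then show ?thesis by (auto simp: strict_mono_Suc_iff)
  next
    case False
    then have *: "\<phi> (\<phi> x) < x" using ne by simp
    have "s (Suc m) < s m" for m
      by (induction m) (use * s0 s1 in simp, simp only: sSuc, rule mono, simp_all add: sX)
    then show ?thesis by (auto simp: strict_mono_Suc_iff)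
  qed
  then obtain g where g: "locally_integrable g" "\<And>x. g x \<ge> 0"
      "\<And>M. \<forall>\<^sub>F m in sequentially. \<forall>y\<in>closed_segment (s m) (s (Suc m)). g y \<ge> M"
    by (rule blow_up_weight) blast
  define a b where "a = min x (\<phi> (\<phi> x))" and "b = max x (\<phi> (\<phi> x))"
  have ab: "a < b" using ne by (auto simp: a_def b_def)
  have seg: "{a..b} = closed_segment (s 0) (s (Suc 0))"
    unfolding s0 s1 a_def b_def by (auto simp: closed_segment_eq_real_ivl)
  have abX': "a \<in> X" "b \<in> X" using x by (auto simp: a_def b_def min_def max_def)
  have abX: "{a..b} \<subseteq> X" using mem_is_interval_1_I[OF interval_X abX'] by (simp add: subset_iff)
  \<comment> \<open>\<phi> \<circ> \<phi> carries the segment between two consecutive orbit points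
    into the next one, so the support of the bump follows the orbit.\<close>
  have orbit: "(\<phi> ^^ (2 * m)) ` {a..b} \<subseteq> closed_segment (s m) (s (Suc m))" for m
  proof (induction m)
    case 0
    then show ?case using seg by simp
  next
    case (Suc m)
    have "\<phi> (\<phi> y) \<in> closed_segment (s (Suc m)) (s (Suc (Suc m)))"
      if y: "y \<in> closed_segment (s m) (s (Suc m))" "y \<in> X" for y
    proof -
      have le: "\<phi> (\<phi> u) \<le> \<phi> (\<phi> v)" if "u \<le> v" "u \<in> X" "v \<in> X" for u v
        using strict_mono_on_leD[OF strict_mono_on_phi_phi that(2,3,1)] .
      have "y \<le> s k \<Longrightarrow> \<phi> (\<phi> y) \<le> s (Suc k)" "s k \<le> y \<Longrightarrow> s (Suc k) \<le> \<phi> (\<phi> y)" for k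
        by (simp_all add: sSuc le sX y(2))
      moreover have "z \<in> closed_segment u v \<longleftrightarrow> u \<le> z \<and> z \<le> v \<or> v \<le> z \<and> z \<le> u" for u v z :: real
        by (auto simp: closed_segment_eq_real_ivl)
      ultimately show ?thesis using y(1) by blast
    qed
    then show ?case using Suc abX funpow_phi_in by (auto simp: image_subset_iff subset_iff)
  qed
  obtain f where f: "f \<in> test_functions {a..b}" "\<And>x. Re (f x) \<ge> 0"
      "\<And>x. a < x \<Longrightarrow> x < b \<Longrightarrow> Re (f x) > 0"
    by (rule bump_function) blast
  have fX: "f \<in> test_functions X" using f(1) abX test_functions_mono by blast
  have f0: "\<And>x. x \<notin> {a..b} \<Longrightarrow> f x = 0" and sm: "smooth f"
    using f(1) by (auto simp: test_functions_compact_iff)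
  define c where "c = integral X (\<lambda>x. Re (f x))"
  have c: "c > 0"
  proof -
    have cont: "continuous_on {a..b} (\<lambda>x. Re (f x))"
      using continuous_on_nth_deriv[OF sm, of _ 0] by (intro continuous_intros) simp
    \<comment> \<open>A continuous non-negative function with integral zero would vanish, but
      \<open>Re f\<close> is positive at the midpoint.\<close>
    have "integral {a..b} (\<lambda>x. Re (f x)) \<noteq> 0"
      using integral_eq_0_iff[OF cont ab] f(2) f(3)[of "(a + b) / 2"] ab by force
    moreover have "integral {a..b} (\<lambda>x. Re (f x)) = c"
      unfolding c_def by (rule integral_spike_set) (use abX f0 in \<open>auto intro!: empty_imp_negligible\<close>)
    moreover have "c \<ge> 0" unfolding c_def
      using Re_integrable[OF fX] f(2) by (intro Henstock_Kurzweil_Integration.integral_nonneg) (auto simp: absolutely_integrable_on_def)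
    ultimately show ?thesis by simp
  qed
  let ?u = "regular_distribution X g"
  \<comment> \<open>The lower bound \<open>M = 0\<close> holds everywhere and so covers odd
    \<open>m\<close>, where nothing is known about growth.\<close>
  have nn: "Re (?u ((S ^^ m) f)) \<ge> 0" for m
    using Re_regular_distribution_funpow_S[where K = "{a..b}" and m = m and M = 0, OF g(1) fX f(2) f0]
      g(2) by simp
  have "filterlim (\<lambda>k. Re (?u ((S ^^ (2 * k)) f))) at_top sequentially"
    unfolding filterlim_at_top
  proof
    fix M
    \<comment> \<open>The weight has to exceed \<open>M / c\<close>, as the pairing is at least its
      lower bound times the mass \<open>c\<close>.\<close>
    show "\<forall>\<^sub>F k in sequentially. M \<le> Re (?u ((S ^^ (2 * k)) f))"
      using g(3)[of "M / c"]
    proof eventually_elim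
      case (elim k)
      then have "Re (?u ((S ^^ (2 * k)) f)) \<ge> M / c * c"
        unfolding c_def using orbit[of k]
        by (intro Re_regular_distribution_funpow_S[where K = "{a..b}", OF g(1) fX f(2) f0]) auto
      then show ?case using c by simp
    qed
  qed
  from not_ergodic[OF regular_distribution_in_distributions[OF g(1)] fX nn this]
  show ?thesis by blast
qed

end

theorem theorem4p9:
  fixes X :: "real set" and \<phi> :: "real \<Rightarrow> real"
  assumes "open X" and "is_interval X" and "X \<noteq> {}"
    and "real_analytic_diffeo X \<phi>"
  shows "(power_bounded (D'_topology X) (comp_op X \<phi>) \<longleftrightarrow>
            mean_ergodic (D'_topology X) (comp_op X \<phi>)) \<and>
         (mean_ergodic (D'_topology X) (comp_op X \<phi>) \<longleftrightarrow>
            uniformly_mean_ergodic (D'_topology X) (comp_op X \<phi>)) \<and>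
         (uniformly_mean_ergodic (D'_topology X) (comp_op X \<phi>) \<longleftrightarrow>
            (\<forall>x\<in>X. \<phi> (\<phi> x) = x)) \<and>
         ((\<forall>x\<in>X. \<phi> (\<phi> x) = x) \<longleftrightarrow>
            (\<forall>u\<in>distributions X. comp_op X \<phi> (comp_op X \<phi> u) = u))"
proof -
  interpret interval_diffeo X \<phi> using assms by unfold_locales
  have "uniformly_mean_ergodic (D'_topology X) T \<Longrightarrow> mean_ergodic (D'_topology X) T"
    unfolding uniformly_mean_ergodic_def mean_ergodic_def by blast
  \<comment> \<open>Each ergodic property forces \<phi> \<circ> \<phi> = id by contraposition. This
    makes \<open>T\<close> an involution, which returns all of them. Conversely, an involutive
    \<open>T\<close> is power bounded, and this again forces \<phi> \<circ> \<phi> = id.\<close>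
  then show ?thesis
    using T_involution ergodic_of_T_involution not_ergodic_of_not_involution by blast
qed

end
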